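(* Let $G$ be a $\Delta$-groupoid with distinguished generating set $H$, and let $(B,\partial)$ be its associated chain complex. The subgroup $A\subset B$ generated by the set of elements $$\bigcup_{n\ge1}\{x+s_ix\mid x\in V_n,\ 1\le i\le n\}$$ is a chain subcomplex of $(B,\partial)$.
   Context: $\Delta$-groupoid: a groupoid $G$ (identified with its set of morphisms; $(x,y)$ composable iff $\mathrm{cod}(x)=\mathrm{dom}(y)$, composite $xy$) with a generating subset $H\subset G$ (in particular every object is the domain of some element of $H$) and an involution $j\colon H\to H$ such that (i) $i(H)=H$ where $i(x)=x^{-1}$; (ii) $iji=jij$ on $H$; (iii) if $(x,y)\in H^2$ is composable then $(k(x),j(y))$ is composable, where $k=iji$; (iv) if $(x,y)\in H^2$ is $H$-composable (composable with $xy\in H$), then $(k(x),j(y))$ is $H$-composable and $k(xy)\,i(k(y))=k(k(x)j(y))$. For an object $A$, put $A^*=\mathrm{dom}(j(x))$ for any $x\in H$ with $\mathrm{dom}(x)=A$ (independent of $x$). For an $H$-composable pair put $x*y=j(k(x)j(y))=i(j(x))\,j(xy)$. Sets $V_n$: $V_{-1}=\{*\}$; $V_0=\pi_0(G)$ (connected components); $V_1=\mathrm{Ob}(G)$; $V_2=H$; $V_3$ is the set of $H$-composable pairs; for $n>2$, $V_{n+1}$ is the set of $(x_1,\dots,x_n)\in H^n$ with $(x_i,x_{i+1})\in V_3$ for $1\le i\le n-1$ and $\partial_i(x_1,\dots,x_n)\in V_n$ for $1\le i\le n+1$. Maps $\partial_i\colon V_{n+1}\to V_n$ for $n\ge2$,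 $0\le i\le n+1$: $\partial_1(x_1,\dots,x_n)=(x_2,\dots,x_n)$; $\partial_i(x_1,\dots,x_n)=(x_1,\dots,x_{i-2},x_{i-1}x_i,x_{i+1},\dots,x_n)$ for $2\le i\le n$; $\partial_{n+1}(x_1,\dots,x_n)=(x_1,\dots,x_{n-1})$; $\partial_0(x_1,\dots,x_n)=(y_1,\dots,y_{n-1})$ with $y_i=z_i*x_{i+1}$, $z_i=x_1x_2\cdots x_i$. In low degrees: $\partial_0\colon V_0\to V_{-1}$ is the unique map; for $A\in V_1$, $\partial_0A=[A^*]$, $\partial_1A=[A]$ ($[A]$ the connected component of $A$); for $x\in V_2$, $\partial_0x=\mathrm{cod}(j(x))$, $\partial_1x=\mathrm{cod}(x)$, $\partial_2x=\mathrm{dom}(x)$. $B_n=\mathbb{Z}V_n$ is the free abelian group on $V_n$ for $n\ge-1$, $B_n=0$ for $n<-1$, $B=\bigoplus_nB_n$, with differential $\partial=\sum_{i\ge0}(-1)^i\partial_i$, where $\partial_i$ is extended linearly and $\partial_i|_{B_n}=0$ for $i>n$ (and $\partial|_{B_{-1}}=0$). $V_n$ carries an action of the symmetric group $\mathbb{S}_{n+1}$ (permutations of $\{0,\dots,n\}$) in which the transposition $s_i=(i-1,i)$, $1\le i\le n$, acts as follows. $n=1$: $s_1(A)=A^*$. $n=2$: $s_1(x)=j(x)$, $s_2(x)=x^{-1}$. $n>2$, on $(x_1,\dots,x_{n-1})\in V_n$: $s_1\mapsto (j(x_1),x_1*x_2,(x_1x_2)*x_3,\dots,(x_1\cdots x_{n-2})*x_{n-1})$;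 $s_2\mapsto(x_1^{-1},x_1x_2,x_3,\dots,x_{n-1})$; $s_i\mapsto(x_1,\dots,x_{i-3},x_{i-2}x_{i-1},x_{i-1}^{-1},x_{i-1}x_i,x_{i+1},\dots,x_{n-1})$ for $2<i<n$; $s_n\mapsto(x_1,\dots,x_{n-3},x_{n-2}x_{n-1},x_{n-1}^{-1})$. *)

theory Defs
  imports "HOL-Algebra.Free_Abelian_Groups" "HOL-Algebra.Generated_Groups"
begin

section \<open>Groupoids\<close>

text \<open>Composition is written in diagrammatic order: the composite of \<open>x\<close> and \<open>y\<close> is defined when
  the codomain of \<open>x\<close> is the domain of \<open>y\<close>.  Outside the carriers all operations are arbitrary.\<close>

record ('o, 'm) groupoid_data =
  Obs :: "'o set"
  Mors :: "'m set"
  src :: "'m \<Rightarrow> 'o"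
  tgt :: "'m \<Rightarrow> 'o"
  idn :: "'o \<Rightarrow> 'm"
  cmp :: "'m \<Rightarrow> 'm \<Rightarrow> 'm"  (infixl "\<cdot>\<index>" 70)
  opp :: "'m \<Rightarrow> 'm"  ("\<i>\<index>")

locale groupoid =
  fixes G :: "('o, 'm, 'z) groupoid_data_scheme" (structure)
  assumes src_closed: "x \<in> Mors G \<Longrightarrow> src G x \<in> Obs G"
    and tgt_closed: "x \<in> Mors G \<Longrightarrow> tgt G x \<in> Obs G"
    and idn_closed: "A \<in> Obs G \<Longrightarrow> idn G A \<in> Mors G \<and> src G (idn G A) = A \<and> tgt G (idn G A) = A"
    and cmp_closed: "\<lbrakk>x \<in> Mors G; y \<in> Mors G; tgt G x = src G y\<rbrakk>
      \<Longrightarrow> x \<cdot> y \<in> Mors G \<and> src G (x \<cdot> y) = src G x \<and> tgt G (x \<cdot> y) = tgt G y"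
    and cmp_assoc: "\<lbrakk>x \<in> Mors G; y \<in> Mors G; z \<in> Mors G; tgt G x = src G y; tgt G y = src G z\<rbrakk>
      \<Longrightarrow> (x \<cdot> y) \<cdot> z = x \<cdot> (y \<cdot> z)"
    and idn_left: "x \<in> Mors G \<Longrightarrow> idn G (src G x) \<cdot> x = x"
    and idn_right: "x \<in> Mors G \<Longrightarrow> x \<cdot> idn G (tgt G x) = x"
    and opp_closed: "x \<in> Mors G \<Longrightarrow> \<i> x \<in> Mors G \<and> src G (\<i> x) = tgt G x \<and> tgt G (\<i> x) = src G x"
    and opp_right: "x \<in> Mors G \<Longrightarrow> x \<cdot> \<i> x = idn G (src G x)"
    and opp_left: "x \<in> Mors G \<Longrightarrow> \<i> x \<cdot> x = idn G (tgt G x)"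

text \<open>Identities are not put into the generated set for free.  Hence, if \<open>S\<close> generates everything,
  then each identity is a composite of elements of \<open>S\<close> and their inverses, so that every object is
  an end point of an element of \<open>S\<close>.\<close>

inductive_set generated :: "('o, 'm, 'z) groupoid_data_scheme \<Rightarrow> 'm set \<Rightarrow> 'm set"
  for G (structure) and S where
  gen_base: "x \<in> S \<Longrightarrow> x \<in> generated G S"
| gen_opp: "x \<in> generated G S \<Longrightarrow> \<i> x \<in> generated G S"
| gen_cmp: "\<lbrakk>x \<in> generated G S; y \<in> generated G S; tgt G x = src G y\<rbrakk> \<Longrightarrow> x \<cdot> y \<in> generated G S"

definition component :: "('o, 'm, 'z) groupoid_data_scheme \<Rightarrow> 'o \<Rightarrow> 'o set" where
  "component G A = {tgt G x | x. x \<in> Mors G \<and> src G x = A}"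


section \<open>\<open>\<Delta>\<close>-groupoids\<close>

record ('o, 'm) delta_data = "('o, 'm) groupoid_data" +
  gens :: "'m set"
  inv_j :: "'m \<Rightarrow> 'm"  ("\<j>\<index>")

definition inv_k :: "('o, 'm, 'z) delta_data_scheme \<Rightarrow> 'm \<Rightarrow> 'm"  ("\<k>\<index>") where
  "\<k>\<^bsub>G\<^esub> x = \<i>\<^bsub>G\<^esub> (\<j>\<^bsub>G\<^esub> (\<i>\<^bsub>G\<^esub> x))"

definition H_composable :: "('o, 'm, 'z) delta_data_scheme \<Rightarrow> 'm \<Rightarrow> 'm \<Rightarrow> bool" where
  "H_composable G x y \<longleftrightarrow>
     x \<in> gens G \<and> y \<in> gens G \<and> tgt G x = src G y \<and> x \<cdot>\<^bsub>G\<^esub> y \<in> gens G"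

locale delta_groupoid = groupoid G
  for G :: "('o, 'm, 'z) delta_data_scheme" (structure) +
  assumes gens_subset: "gens G \<subseteq> Mors G"
    and gens_generate: "Mors G \<subseteq> generated G (gens G)"
    and j_closed: "x \<in> gens G \<Longrightarrow> \<j> x \<in> gens G"
    and j_involution: "x \<in> gens G \<Longrightarrow> \<j> (\<j> x) = x"
    and i_gens: "\<i> ` gens G = gens G"
    and iji_eq_jij: "x \<in> gens G \<Longrightarrow> \<i> (\<j> (\<i> x)) = \<j> (\<i> (\<j> x))"
    and k_j_composable: "\<lbrakk>x \<in> gens G; y \<in> gens G; tgt G x = src G y\<rbrakk>
      \<Longrightarrow> tgt G (\<k> x) = src G (\<j> y)"
    and k_j_H_composable: "H_composable G x y \<Longrightarrow> H_composable G (\<k> x) (\<j> y)"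
    and k_cmp: "H_composable G x y \<Longrightarrow> \<k> (x \<cdot> y) \<cdot> \<i> (\<k> y) = \<k> (\<k> x \<cdot> \<j> y)"

text \<open>In a \<open>\<Delta>\<close>-groupoid the choice made here exists and does not affect the value.\<close>

definition star_ob :: "('o, 'm, 'z) delta_data_scheme \<Rightarrow> 'o \<Rightarrow> 'o" where
  "star_ob G A = src G (\<j>\<^bsub>G\<^esub> (SOME x. x \<in> gens G \<and> src G x = A))"

definition star_mor :: "('o, 'm, 'z) delta_data_scheme \<Rightarrow> 'm \<Rightarrow> 'm \<Rightarrow> 'm"  (infixl "\<star>\<index>" 70) where
  "x \<star>\<^bsub>G\<^esub> y = \<j>\<^bsub>G\<^esub> (\<k>\<^bsub>G\<^esub> x \<cdot>\<^bsub>G\<^esub> \<j>\<^bsub>G\<^esub> y)"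


section \<open>Simplices and faces\<close>

text \<open>Lists are indexed from 0, so the entry \<open>x\<^sub>i\<close> of a tuple \<open>xs\<close> is \<open>xs ! (i - 1)\<close>.\<close>

definition list_cmp :: "('o, 'm, 'z) delta_data_scheme \<Rightarrow> 'm list \<Rightarrow> 'm" where
  "list_cmp G xs = foldl (cmp G) (hd xs) (tl xs)"

text \<open>The list of all \<open>(x\<^sub>1 \<cdot> \<dots> \<cdot> x\<^sub>k) \<star> x\<^sub>k\<^sub>+\<^sub>1\<close>.\<close>

definition star_list :: "('o, 'm, 'z) delta_data_scheme \<Rightarrow> 'm list \<Rightarrow> 'm list" where
  "star_list G xs = map (\<lambda>k. list_cmp G (take k xs) \<star>\<^bsub>G\<^esub> xs ! k) [1..<length xs]"

text \<open>The faces of a tuple of length at least 2.\<close>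

definition tuple_face :: "('o, 'm, 'z) delta_data_scheme \<Rightarrow> nat \<Rightarrow> 'm list \<Rightarrow> 'm list" where
  "tuple_face G i xs =
    (if i = 0 then star_list G xs
     else if i = 1 then tl xs
     else if i \<le> length xs
       then take (i - 2) xs @ [xs ! (i - 2) \<cdot>\<^bsub>G\<^esub> xs ! (i - 1)] @ drop i xs
     else butlast xs)"

text \<open>\<open>tuples G m\<close> is the set \<open>V\<^sub>m\<^sub>+\<^sub>1\<close>, which consists of tuples of length \<open>m\<close>.\<close>

fun tuples :: "('o, 'm, 'z) delta_data_scheme \<Rightarrow> nat \<Rightarrow> 'm list set" where
  "tuples G 0 = {}"
| "tuples G (Suc 0) = {[x] | x. x \<in> gens G}"
| "tuples G (Suc (Suc 0)) = {[x, y] | x y. H_composable G x y}"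
| "tuples G (Suc (Suc (Suc m))) =
     {xs. length xs = m + 3 \<and> set xs \<subseteq> gens G
        \<and> (\<forall>i<m + 2. H_composable G (xs ! i) (xs ! (i + 1)))
        \<and> (\<forall>i\<in>{1..m + 4}. tuple_face G i xs \<in> tuples G (Suc (Suc m)))}"

text \<open>The constructors make the sets \<open>V\<^sub>n\<close> disjoint.\<close>

datatype ('o, 'm) simplex = Point | Component "'o set" | Object 'o | Tuple "'m list"

definition V :: "('o, 'm, 'z) delta_data_scheme \<Rightarrow> int \<Rightarrow> ('o, 'm) simplex set" where
  "V G n =
    (if n < -1 then {}
     else if n = -1 then {Point}
     else if n = 0 then (\<lambda>A. Component (component G A)) ` Obs G
     else if n = 1 then Object ` Obs G
     else Tuple ` tuples G (nat (n - 1)))"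

fun dim :: "('o, 'm) simplex \<Rightarrow> int" where
  "dim Point = -1"
| "dim (Component C) = 0"
| "dim (Object A) = 1"
| "dim (Tuple xs) = int (length xs) + 1"

text \<open>Only the indices from 0 to the dimension of the simplex matter.\<close>

fun face :: "('o, 'm, 'z) delta_data_scheme \<Rightarrow> nat \<Rightarrow> ('o, 'm) simplex \<Rightarrow> ('o, 'm) simplex" where
  "face G i Point = undefined"
| "face G i (Component C) = Point"
| "face G i (Object A) =
     (if i = 0 then Component (component G (star_ob G A)) else Component (component G A))"
| "face G i (Tuple [x]) =
     (if i = 0 then Object (tgt G (\<j>\<^bsub>G\<^esub> x))
      else if i = 1 then Object (tgt G x)
      else Object (src G x))"
| "face G i (Tuple xs) = Tuple (tuple_face G i xs)"


section \<open>The action of the adjacent transpositions\<close>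

text \<open>For tuples of length \<open>n - 1 \<ge> 2\<close> and \<open>1 \<le> i \<le> n\<close>.\<close>

definition tuple_swap :: "('o, 'm, 'z) delta_data_scheme \<Rightarrow> nat \<Rightarrow> 'm list \<Rightarrow> 'm list" where
  "tuple_swap G i xs =
    (if i = 1 then \<j>\<^bsub>G\<^esub> (hd xs) # star_list G xs
     else if i = 2 then [\<i>\<^bsub>G\<^esub> (xs ! 0), xs ! 0 \<cdot>\<^bsub>G\<^esub> xs ! 1] @ drop 2 xs
     else if i \<le> length xs
       then take (i - 3) xs @ [xs ! (i - 3) \<cdot>\<^bsub>G\<^esub> xs ! (i - 2), \<i>\<^bsub>G\<^esub> (xs ! (i - 2)),
              xs ! (i - 2) \<cdot>\<^bsub>G\<^esub> xs ! (i - 1)] @ drop i xs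
     else take (i - 3) xs @ [xs ! (i - 3) \<cdot>\<^bsub>G\<^esub> xs ! (i - 2), \<i>\<^bsub>G\<^esub> (xs ! (i - 2))])"

fun swap :: "('o, 'm, 'z) delta_data_scheme \<Rightarrow> nat \<Rightarrow> ('o, 'm) simplex \<Rightarrow> ('o, 'm) simplex" where
  "swap G i (Object A) = Object (star_ob G A)"
| "swap G i (Tuple [x]) = (if i = 1 then Tuple [\<j>\<^bsub>G\<^esub> x] else Tuple [\<i>\<^bsub>G\<^esub> x])"
| "swap G i (Tuple xs) = Tuple (tuple_swap G i xs)"
| "swap G i v = undefined"


section \<open>Chain complexes\<close>

text \<open>A chain complex is an abelian group (written multiplicatively) that is the internal direct
  sum of subgroups \<open>deg n\<close>, with a differential of degree \<open>-1\<close>.  A subcomplex is a subgroup that is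
  graded, that is, spanned by its homogeneous elements, and stable under the differential.\<close>

locale chain_complex = comm_group C for C :: "('a, 'z) monoid_scheme" (structure) +
  fixes deg :: "int \<Rightarrow> 'a set" and d :: "'a \<Rightarrow> 'a"
  assumes deg_subgroup: "subgroup (deg n) C"
    and deg_span: "generate C (\<Union>n. deg n) = carrier C"
    and deg_independent: "deg n \<inter> generate C (\<Union>m\<in>-{n}. deg m) = {\<one>}"
    and d_hom: "d \<in> hom C C"
    and d_deg: "d ` deg n \<subseteq> deg (n - 1)"
    and d_d: "x \<in> carrier C \<Longrightarrow> d (d x) = \<one>"

locale chain_subcomplex = chain_complex C deg d
  for C :: "('a, 'z) monoid_scheme" (structure) and deg and d +
  fixes A :: "'a set"
  assumes sub_subgroup: "subgroup A C"
    and sub_graded: "generate C (\<Union>n. A \<inter> deg n) = A"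
    and sub_d: "d ` A \<subseteq> A"


section \<open>The complex of a \<open>\<Delta>\<close>-groupoid\<close>

definition B :: "('o, 'm, 'z) delta_data_scheme \<Rightarrow> (('o, 'm) simplex \<Rightarrow>\<^sub>0 int) monoid" where
  "B G = free_Abelian_group (\<Union>n. V G n)"

definition B_deg :: "('o, 'm, 'z) delta_data_scheme \<Rightarrow> int \<Rightarrow> (('o, 'm) simplex \<Rightarrow>\<^sub>0 int) set" where
  "B_deg G n = carrier (free_Abelian_group (V G n))"

definition boundary :: "('o, 'm, 'z) delta_data_scheme
    \<Rightarrow> (('o, 'm) simplex \<Rightarrow>\<^sub>0 int) \<Rightarrow> (('o, 'm) simplex \<Rightarrow>\<^sub>0 int)" where
  "boundary G =
     frag_extend (\<lambda>v. \<Sum>i | int i \<le> dim v. frag_cmul ((-1) ^ i) (frag_of (face G i v)))"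

definition swap_subgroup :: "('o, 'm, 'z) delta_data_scheme \<Rightarrow> (('o, 'm) simplex \<Rightarrow>\<^sub>0 int) set" where
  "swap_subgroup G =
     generate (B G) {frag_of v + frag_of (swap G i v) | n i v.
       1 \<le> n \<and> v \<in> V G n \<and> 1 \<le> i \<and> int i \<le> n}"

end

theory Submission
  imports Defs "HOL-Combinatorics.Transposition"
begin

text \<open>A simplex \<open>(x\<^sub>1, \<dots>, x\<^sub>n\<^sub>-\<^sub>1)\<close> with vertices \<open>0, \<dots>, n\<close> is the same thing as a family of elements
  \<open>T a b c\<close> of \<open>H\<close>, indexed by the triples of distinct vertices, such that \<open>T b a c = j (T a b c)\<close>,
  \<open>T a c b = (T a b c)\<inverse>\<close> and \<open>T a b c \<cdot> T a c d = T a b d\<close>; the entries of the tuple are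
  \<open>x\<^sub>i = T 0 i (i + 1)\<close>.  Faces and adjacent transpositions then become reindexing along the
  coface maps and transpositions of vertices, so that the simplicial identities and the relations
  between faces and transpositions reduce to identities between maps of vertices.\<close>

section \<open>Calculus in groupoids\<close>

context groupoid
begin

text \<open>Behind \<open>T a b c\<close> stands the picture of a morphism from the edge
  \<open>(a, b)\<close> to the edge \<open>(a, c)\<close>. Its source depends on \<open>a\<close>
  and \<open>b\<close> alone, so objects act as oriented edges, \<open>star_ob\<close> reverses an
  edge, and the edges starting at a vertex lie in one component, which stands for that vertex. The
  axiom \<open>iji_eq_jij\<close> becomes the braid relation of the symmetric group on three
  vertices. The obstacle is that \<open>tuples\<close> constrains only faces of index at least 1,
  while the face of index 0 and the first transposition change the base vertex of every entry and
  must be shown to stay inside \<open>tuples\<close>. For families the vertex 0 is not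
  distinguished, so reindexing settles this at once. The work moves into one statement, that each
  tuple extends to a family, which rests on the axioms on \<open>\<k>\<close>. Triples of vertices
  exist only from dimension 2 on, so faces that are objects or components are handled apart.\<close>

lemma mor_simps [simp]:
  assumes "x \<in> Mors G"
  shows "src G x \<in> Obs G" "tgt G x \<in> Obs G" "\<i> x \<in> Mors G"
    "src G (\<i> x) = tgt G x" "tgt G (\<i> x) = src G x"
    "src G x = A \<Longrightarrow> idn G A \<cdot> x = x" "tgt G x = A \<Longrightarrow> x \<cdot> idn G A = x"
    "x \<cdot> \<i> x = idn G (src G x)" "\<i> x \<cdot> x = idn G (tgt G x)"
  using assms src_closed tgt_closed opp_closed idn_left idn_right opp_right opp_left by auto

lemma idn_simps [simp]:
  assumes "A \<in> Obs G"
  shows "idn G A \<in> Mors G" "src G (idn G A) = A" "tgt G (idn G A) = A"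
  using assms idn_closed by auto

lemma cmp_simps [simp]:
  assumes "x \<in> Mors G" "y \<in> Mors G" "tgt G x = src G y"
  shows "x \<cdot> y \<in> Mors G" "src G (x \<cdot> y) = src G x" "tgt G (x \<cdot> y) = tgt G y"
  using assms cmp_closed by auto

lemma opp_unique:
  assumes "x \<in> Mors G" "y \<in> Mors G" "tgt G x = src G y" "x \<cdot> y = idn G (src G x)"
  shows "\<i> x = y"
proof -
  have "\<i> x = \<i> x \<cdot> (x \<cdot> y)"
    using assms by simp
  also have "\<dots> = (\<i> x \<cdot> x) \<cdot> y"
    using assms(1-3) by (intro cmp_assoc[symmetric]) auto
  also have "\<dots> = y"
    using assms by simp
  finally show ?thesis .
qed

lemma opp_opp [simp]: "x \<in> Mors G \<Longrightarrow> \<i> (\<i> x) = x"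
  by (rule opp_unique) auto

lemma opp_idn [simp]: "A \<in> Obs G \<Longrightarrow> \<i> (idn G A) = idn G A"
  by (metis idn_simps mor_simps(6) opp_unique)

lemma opp_cmp_cancel:
  assumes "x \<in> Mors G" "y \<in> Mors G" "tgt G x = src G y"
  shows "\<i> x \<cdot> (x \<cdot> y) = y"
  using assms cmp_assoc[of "\<i> x" x y] by simp

lemma cmp_opp_cancel:
  assumes "x \<in> Mors G" "y \<in> Mors G" "src G x = src G y"
  shows "x \<cdot> (\<i> x \<cdot> y) = y"
  using assms cmp_assoc[of x "\<i> x" y] by simp

lemma opp_cmp:
  assumes "x \<in> Mors G" "y \<in> Mors G" "tgt G x = src G y"
  shows "\<i> (x \<cdot> y) = \<i> y \<cdot> \<i> x"
  by (rule opp_unique) (use assms in \<open>simp_all add: cmp_assoc cmp_opp_cancel\<close>)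

lemma opp_quotient:
  assumes "x \<in> Mors G" "y \<in> Mors G" "src G x = src G y"
  shows "\<i> (\<i> x \<cdot> y) = \<i> y \<cdot> x"
  using assms by (simp add: opp_cmp)

lemma quotient_cmp:
  assumes "x \<in> Mors G" "y \<in> Mors G" "z \<in> Mors G" "src G x = src G y" "src G y = src G z"
  shows "(\<i> x \<cdot> y) \<cdot> (\<i> y \<cdot> z) = \<i> x \<cdot> z"
  using assms by (simp add: cmp_assoc cmp_opp_cancel)

lemma component_eq:
  assumes "x \<in> Mors G"
  shows "component G (src G x) = component G (tgt G x)"
proof -
  have *: "component G (tgt G y) \<subseteq> component G (src G y)" if "y \<in> Mors G" for y
    using that unfolding component_def by clarsimp (metis cmp_simps)
  show ?thesis
    using *[OF assms] *[of "\<i> x"] assms by auto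
qed

end

section \<open>Generators and the star operation\<close>

context delta_groupoid
begin

lemma gens_Mors [simp]: "x \<in> gens G \<Longrightarrow> x \<in> Mors G"
  using gens_subset by auto

lemma i_closed [simp]: "x \<in> gens G \<Longrightarrow> \<i> x \<in> gens G"
  using i_gens by auto

declare j_closed [simp] j_involution [simp]

lemma H_composableD:
  assumes "H_composable G x y"
  shows "x \<in> gens G" "y \<in> gens G" "tgt G x = src G y" "x \<cdot> y \<in> gens G"
  using assms by (auto simp: H_composable_def)

text \<open>Since \<open>\<k> (\<i> x) = \<i> (\<j> x)\<close> has target
  \<open>src G (\<j> x)\<close>, this is the axiom \<open>k_j_composable\<close> for the composable
  pair \<open>\<i> x\<close>, \<open>y\<close>. It makes \<open>star_ob\<close> independent of the
  choice in its definition.\<close>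

lemma src_j_cong:
  assumes "x \<in> gens G" "y \<in> gens G" "src G x = src G y"
  shows "src G (\<j> x) = src G (\<j> y)"
  using k_j_composable[of "\<i> x" y] assms by (simp add: inv_k_def)

lemma star_ob_src: "x \<in> gens G \<Longrightarrow> star_ob G (src G x) = src G (\<j> x)"
  unfolding star_ob_def by (rule someI2[of _ x]) (auto intro: src_j_cong)

text \<open>Targets can be phrased as sources of generators because \<open>gens G\<close> is closed
  under inversion. Applied to an identity, this puts a generator at every object.\<close>

lemma generated_ends:
  assumes "x \<in> generated G (gens G)"
  shows "x \<in> Mors G \<and> src G x \<in> src G ` gens G \<and> tgt G x \<in> src G ` gens G"
  using assms
proof induction
  case (gen_base x)
  then have "src G (\<i> x) \<in> src G ` gens G"
    by (intro imageI) simp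
  then show ?case
    using gen_base by simp
qed auto

lemma Obs_gens:
  assumes "A \<in> Obs G"
  obtains x where "x \<in> gens G" "src G x = A"
proof -
  have "idn G A \<in> generated G (gens G)"
    using gens_generate idn_simps(1)[OF assms] by auto
  then show thesis
    using generated_ends idn_simps(2)[OF assms] that by fastforce
qed

lemma star_ob_closed: "A \<in> Obs G \<Longrightarrow> star_ob G A \<in> Obs G"
  by (metis Obs_gens gens_Mors j_closed mor_simps(1) star_ob_src)

lemma star_ob_star_ob: "A \<in> Obs G \<Longrightarrow> star_ob G (star_ob G A) = A"
  by (metis Obs_gens j_closed j_involution star_ob_src)

lemma star_mor_closed: "H_composable G x y \<Longrightarrow> x \<star> y \<in> gens G"
  unfolding star_mor_def by (intro j_closed H_composableD(4) k_j_H_composable)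

text \<open>The axiom for \<open>k\<close> is applied to the inverse pair.\<close>

lemma star_mor_eq:
  assumes "H_composable G x y"
  shows "x \<star> y = \<i> (\<j> x) \<cdot> \<j> (x \<cdot> y)"
proof -
  note xy = H_composableD[OF assms]
  have hc: "H_composable G (\<i> y) (\<i> x)"
    using xy i_closed[OF xy(4)] by (auto simp: H_composable_def opp_cmp)
  \<comment> \<open>The reason for inverting the pair: on inverses \<open>\<k>\<close> turns into
    \<open>\<i>\<close> after \<open>\<j>\<close>, so an identity about \<open>\<k>\<close> becomes
    one about \<open>\<j>\<close>.\<close>
  have k_i: "\<k> (\<i> z) = \<i> (\<j> z)" if "z \<in> gens G" for z
    using that by (simp add: inv_k_def)
  note kj = H_composableD[OF k_j_H_composable[OF assms]]
  have "\<i> (\<j> (x \<cdot> y)) \<cdot> \<j> x = \<k> (\<i> y \<cdot> \<i> x) \<cdot> \<i> (\<k> (\<i> x))"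
    using xy by (simp add: k_i flip: opp_cmp)
  also have "\<dots> = \<k> (\<i> (\<j> y) \<cdot> \<i> (\<k> x))"
    using k_cmp[OF hc] xy by (simp add: k_i) (simp add: inv_k_def)
  also have "\<dots> = \<i> (x \<star> y)"
    using kj xy by (simp add: k_i star_mor_def flip: opp_cmp)
  finally have "\<i> (\<i> (x \<star> y)) = \<i> (\<i> (\<j> (x \<cdot> y)) \<cdot> \<j> x)"
    by simp
  moreover have "src G (\<j> (x \<cdot> y)) = src G (\<j> x)"
    using xy by (intro src_j_cong) auto
  ultimately show ?thesis
    using xy star_mor_closed[OF assms] by (simp add: opp_quotient)
qed

end

section \<open>Cocycles\<close>

text \<open>The morphism \<open>T a b c\<close> is attached to the triangle with vertices \<open>a, b, c\<close>.\<close>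

definition tup :: "nat \<Rightarrow> (nat \<Rightarrow> nat \<Rightarrow> nat \<Rightarrow> 'm) \<Rightarrow> 'm list" where
  "tup n T = map (\<lambda>i. T 0 i (Suc i)) [1..<n]"

definition pull :: "(nat \<Rightarrow> nat) \<Rightarrow> (nat \<Rightarrow> nat \<Rightarrow> nat \<Rightarrow> 'm) \<Rightarrow> nat \<Rightarrow> nat \<Rightarrow> nat \<Rightarrow> 'm" where
  "pull f T a b c = T (f a) (f b) (f c)"

definition coface :: "nat \<Rightarrow> nat \<Rightarrow> nat" where
  "coface i a = (if a < i then a else Suc a)"

lemma length_tup [simp]: "length (tup n T) = n - 1"
  by (simp add: tup_def)

lemma nth_tup [simp]: "k < n - 1 \<Longrightarrow> tup n T ! k = T 0 (Suc k) (Suc (Suc k))"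
  by (simp add: tup_def)

lemma tup_2: "tup 2 T = [T 0 1 2]"
  by (simp add: tup_def numeral_2_eq_2)

lemma tup_3: "tup 3 T = [T 0 1 2, T 0 2 3]"
  by (simp add: tup_def numeral_2_eq_2 numeral_3_eq_3)

lemma list_cmp_append: "xs \<noteq> [] \<Longrightarrow> list_cmp G (xs @ [y]) = list_cmp G xs \<cdot>\<^bsub>G\<^esub> y"
  by (simp add: list_cmp_def)

context delta_groupoid
begin

text \<open>For fixed \<open>a\<close> the last clause is a multiplicative cocycle identity in the
  other vertices, hence the name.\<close>

definition cocycle :: "nat \<Rightarrow> (nat \<Rightarrow> nat \<Rightarrow> nat \<Rightarrow> 'm) \<Rightarrow> bool" where
  "cocycle n T \<longleftrightarrow>
     (\<forall>a b c. {a, b, c} \<subseteq> {..n} \<longrightarrow> distinct [a, b, c] \<longrightarrow>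
        T a b c \<in> gens G \<and> T a c b = \<i> (T a b c) \<and> T b a c = \<j> (T a b c)) \<and>
     (\<forall>a b c d. {a, b, c, d} \<subseteq> {..n} \<longrightarrow> distinct [a, b, c, d] \<longrightarrow>
        tgt G (T a b c) = src G (T a c d) \<and> T a b c \<cdot> T a c d = T a b d)"

lemma cocycleI:
  assumes "\<And>a b c. \<lbrakk>a \<le> n; b \<le> n; c \<le> n; a \<noteq> b; a \<noteq> c; b \<noteq> c\<rbrakk> \<Longrightarrow> T a b c \<in> gens G"
    and "\<And>a b c. \<lbrakk>a \<le> n; b \<le> n; c \<le> n; a \<noteq> b; a \<noteq> c; b \<noteq> c\<rbrakk> \<Longrightarrow> T a c b = \<i> (T a b c)"
    and "\<And>a b c. \<lbrakk>a \<le> n; b \<le> n; c \<le> n; a \<noteq> b; a \<noteq> c; b \<noteq> c\<rbrakk> \<Longrightarrow> T b a c = \<j> (T a b c)"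
    and "\<And>a b c d. \<lbrakk>a \<le> n; b \<le> n; c \<le> n; d \<le> n; a \<noteq> b; a \<noteq> c; a \<noteq> d; b \<noteq> c; b \<noteq> d; c \<noteq> d\<rbrakk>
      \<Longrightarrow> tgt G (T a b c) = src G (T a c d)"
    and "\<And>a b c d. \<lbrakk>a \<le> n; b \<le> n; c \<le> n; d \<le> n; a \<noteq> b; a \<noteq> c; a \<noteq> d; b \<noteq> c; b \<noteq> d; c \<noteq> d\<rbrakk>
      \<Longrightarrow> T a b c \<cdot> T a c d = T a b d"
  shows "cocycle n T"
  unfolding cocycle_def by (intro conjI allI impI; rule assms) simp_all

lemma cocycleD:
  assumes "cocycle n T" "a \<le> n" "b \<le> n" "c \<le> n" "a \<noteq> b" "a \<noteq> c" "b \<noteq> c"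
  shows "T a b c \<in> gens G" "T a c b = \<i> (T a b c)" "T b a c = \<j> (T a b c)"
proof -
  have "{a, b, c} \<subseteq> {..n}" "distinct [a, b, c]"
    using assms(2-) by auto
  then show "T a b c \<in> gens G" "T a c b = \<i> (T a b c)" "T b a c = \<j> (T a b c)"
    using assms(1) unfolding cocycle_def by blast+
qed

lemma cocycle_cmp:
  assumes "cocycle n T" "a \<le> n" "b \<le> n" "c \<le> n" "d \<le> n"
    "a \<noteq> b" "a \<noteq> c" "a \<noteq> d" "b \<noteq> c" "b \<noteq> d" "c \<noteq> d"
  shows "tgt G (T a b c) = src G (T a c d)" "T a b c \<cdot> T a c d = T a b d"
proof -
  have "{a, b, c, d} \<subseteq> {..n}" "distinct [a, b, c, d]"
    using assms(2-) by auto
  then show "tgt G (T a b c) = src G (T a c d)" "T a b c \<cdot> T a c d = T a b d"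
    using assms(1) unfolding cocycle_def by blast+
qed

lemma cocycle_H_composable:
  assumes "cocycle n T" "a \<le> n" "b \<le> n" "c \<le> n" "d \<le> n"
    "a \<noteq> b" "a \<noteq> c" "a \<noteq> d" "b \<noteq> c" "b \<noteq> d" "c \<noteq> d"
  shows "H_composable G (T a b c) (T a c d)"
  unfolding H_composable_def using assms cocycle_cmp[OF assms] cocycleD(1)[OF assms(1)] by simp

text \<open>As \<open>\<k>\<close> exchanges the outer vertices,
  \<open>\<k> (T a b c) \<cdot> \<j> (T a c d)\<close> is
  \<open>T c b a \<cdot> T c a d = T c b d\<close>, and the final \<open>\<j>\<close> exchanges
  \<open>c\<close> and \<open>b\<close>.\<close>

lemma cocycle_star:
  assumes "cocycle n T" "a \<le> n" "b \<le> n" "c \<le> n" "d \<le> n"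
    "a \<noteq> b" "a \<noteq> c" "a \<noteq> d" "b \<noteq> c" "b \<noteq> d" "c \<noteq> d"
  shows "T a b c \<star> T a c d = T b c d"
proof -
  note C = cocycleD[OF assms(1)]
  have "\<k> (T a b c) = T c b a"
    unfolding inv_k_def using C(2)[of a b c] C(3)[of a c b] C(2)[of c a b] assms by metis
  moreover have "\<j> (T a c d) = T c a d"
    using C(3)[of a c d] assms by metis
  moreover have "\<j> (T c b d) = T b c d"
    using C(3)[of c b d] assms by metis
  ultimately show ?thesis
    unfolding star_mor_def using cocycle_cmp(2)[of n T c b a d] assms by metis
qed

text \<open>Injectivity keeps triples distinct, and the order of the vertices does not occur in
  \<open>cocycle\<close>; hence cofaces and transpositions are covered by the same argument.\<close>

lemma cocycle_pull:
  assumes T: "cocycle n T" and f: "inj_on f {..m}" "f ` {..m} \<subseteq> {..n}"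
  shows "cocycle m (pull f T)"
proof -
  have le: "f a \<le> n" if "a \<le> m" for a
    using f(2) that by auto
  have ne: "f a \<noteq> f b" if "a \<le> m" "b \<le> m" "a \<noteq> b" for a b
    using f(1) that by (auto simp: inj_on_def)
  show ?thesis
    by (rule cocycleI; unfold pull_def; rule cocycleD[OF T] cocycle_cmp[OF T]) (simp_all add: le ne)
qed

lemma cocycle_coface: "\<lbrakk>cocycle (Suc n) T; i \<le> Suc n\<rbrakk> \<Longrightarrow> cocycle n (pull (coface i) T)"
  by (erule cocycle_pull) (auto simp: coface_def inj_on_def split: if_splits)

lemma cocycle_transpose: "\<lbrakk>cocycle n T; i \<le> n\<rbrakk> \<Longrightarrow> cocycle n (pull (transpose (i - 1) i) T)"
  by (erule cocycle_pull) (auto simp: transpose_def)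

section \<open>Products, faces and transpositions of the tuple of a family\<close>

lemma list_cmp_tup:
  assumes T: "cocycle n T"
  shows "Suc k < n \<Longrightarrow> list_cmp G (take (Suc k) (tup n T)) = T 0 1 (Suc (Suc k))"
proof (induction k)
  case 0
  then show ?case
    by (simp add: take_Suc_conv_app_nth list_cmp_def)
next
  case (Suc k)
  then have "take (Suc (Suc k)) (tup n T) = take (Suc k) (tup n T) @ [tup n T ! Suc k]"
    by (intro take_Suc_conv_app_nth) simp
  then have "list_cmp G (take (Suc (Suc k)) (tup n T))
      = list_cmp G (take (Suc k) (tup n T)) \<cdot> tup n T ! Suc k"
    using Suc by (simp add: list_cmp_append del: take_Suc flip: length_0_conv)
  then show ?case
    using Suc cocycle_cmp(2)[OF T, of 0 1 "Suc (Suc k)" "Suc (Suc (Suc k))"] by simp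
qed

text \<open>The products of initial entries telescope to \<open>T 0 1 k\<close>, and
  \<open>\<star>\<close> with the next entry then moves the base vertex from 0 to 1, which is what
  omitting vertex 0 does.\<close>

lemma star_list_tup:
  assumes T: "cocycle (Suc n) T"
  shows "star_list G (tup (Suc n) T) = tup n (pull Suc T)"
proof (rule nth_equalityI)
  fix k assume "k < length (star_list G (tup (Suc n) T))"
  then have k: "k < n - 1"
    by (simp add: star_list_def)
  then show "star_list G (tup (Suc n) T) ! k = tup n (pull Suc T) ! k"
    using list_cmp_tup[OF T, of k]
      cocycle_star[OF T, of 0 1 "Suc (Suc k)" "Suc (Suc (Suc k))"]
    by (simp add: star_list_def pull_def)
qed (simp add: star_list_def)

lemma tuple_face_tup:
  assumes T: "cocycle (Suc n) T" and n: "2 \<le> n" and i: "i \<le> Suc n"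
  shows "tuple_face G i (tup (Suc n) T) = tup n (pull (coface i) T)"
proof -
  consider "i = 0" | "i = 1" | "2 \<le> i" "i \<le> n" | "i = Suc n"
    using i by linarith
  then show ?thesis
  proof cases
    case 1
    moreover have "coface 0 = Suc"
      by (auto simp: coface_def)
    ultimately show ?thesis
      using star_list_tup[OF T] by (simp add: tuple_face_def)
  next
    case 2
    then show ?thesis
      using n by (auto simp: tuple_face_def nth_tl pull_def coface_def intro!: nth_equalityI)
  next
    case 3
    \<comment> \<open>Omitting vertex \<open>i\<close> leaves a jump from \<open>i - 1\<close> to
      \<open>i + 1\<close>, which is the composed entry.\<close>
    have c: "T 0 (i - 1) i \<cdot> T 0 i (Suc i) = T 0 (i - 1) (Suc i)"
      using 3 by (intro cocycle_cmp(2)[OF T]) auto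
    show ?thesis
    proof (rule nth_equalityI)
      show "length (tuple_face G i (tup (Suc n) T)) = length (tup n (pull (coface i) T))"
        using 3 by (simp add: tuple_face_def)
    next
      fix k assume "k < length (tuple_face G i (tup (Suc n) T))"
      then have k: "k < n - 1"
        using 3 by (simp add: tuple_face_def)
      consider "k < i - 2" | "k = i - 2" | "k > i - 2"
        by linarith
      then show "tuple_face G i (tup (Suc n) T) ! k = tup n (pull (coface i) T) ! k"
        using 3 c k
        by cases (auto simp: tuple_face_def nth_append pull_def coface_def Suc_diff_Suc numeral_2_eq_2)
    qed
  next
    case 4
    then show ?thesis
      using n by (auto simp: tuple_face_def nth_butlast pull_def coface_def intro!: nth_equalityI)
  qed
qed

text \<open>Only the first transposition moves the base vertex 0. For \<open>i \<ge> 2\<close> just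
  the entries \<open>T 0 k (k + 1)\<close> with \<open>k\<close> among \<open>i - 2\<close>,
  \<open>i - 1\<close>, \<open>i\<close> involve an exchanged vertex; the first of them is missing
  for \<open>i = 2\<close> and the last for \<open>i = n\<close>, which explains the separate
  formulas.\<close>

lemma tuple_swap_tup:
  assumes T: "cocycle n T" and n: "3 \<le> n" and i: "1 \<le> i" "i \<le> n"
  shows "tuple_swap G i (tup n T) = tup n (pull (transpose (i - 1) i) T)"
proof -
  note C = cocycleD[OF T]
  consider "i = 1" | "i = 2" | "3 \<le> i" "i < n" | "3 \<le> i" "i = n"
    using i by linarith
  then show ?thesis
  proof cases
    case 1
    have star: "star_list G (tup n T) = tup (n - 1) (pull Suc T)"
      using star_list_tup[of "n - 1" T] T n by simp
    have hd: "hd (tup n T) = T 0 1 2"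
      using n by (simp add: hd_conv_nth numeral_2_eq_2 flip: length_greater_0_conv)
    show ?thesis
    proof (rule nth_equalityI)
      fix k assume "k < length (tuple_swap G i (tup n T))"
      then have "k < n - 1"
        using 1 n by (simp add: tuple_swap_def star)
      then show "tuple_swap G i (tup n T) ! k = tup n (pull (transpose (i - 1) i) T) ! k"
        using 1 C(3)[of 0 1 2] n
        by (cases k) (simp_all add: tuple_swap_def star hd pull_def transpose_def numeral_2_eq_2)
    qed (use 1 n in \<open>simp add: tuple_swap_def star\<close>)
  next
    case 2
    show ?thesis
    proof (rule nth_equalityI)
      fix k assume "k < length (tuple_swap G i (tup n T))"
      then have k: "k < n - 1"
        using 2 n by (simp add: tuple_swap_def)
      have e: "T 0 1 2 \<cdot> T 0 2 3 = T 0 1 3" "T 0 2 1 = \<i> (T 0 1 2)"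
        using n by (intro cocycle_cmp(2)[OF T] C(2); simp)+
      consider "k = 0" | "k = 1" | l where "k = l + 2"
        by (metis One_nat_def add_2_eq_Suc' not0_implies_Suc)
      then show "tuple_swap G i (tup n T) ! k = tup n (pull (transpose (i - 1) i) T) ! k"
        using 2 n k e
        by cases (simp_all add: tuple_swap_def pull_def transpose_def numeral_2_eq_2 numeral_3_eq_3)
    qed (use 2 n in \<open>simp add: tuple_swap_def\<close>)
  next
    case 3
    \<comment> \<open>This removes truncated subtractions; \<open>l\<close> is the list index of the
      first entry that changes.\<close>
    then obtain l where l: "i = l + 3"
      by (metis add.commute le_Suc_ex)
    show ?thesis
    proof (rule nth_equalityI)
      fix k assume "k < length (tuple_swap G i (tup n T))"
      then have k: "k < n - 1"
        using 3 by (simp add: tuple_swap_def split: if_splits)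
      have il: "l + 3 \<le> n - 1"
        using 3 l by linarith
      have e: "T 0 (l + 1) (l + 2) \<cdot> T 0 (l + 2) (l + 3) = T 0 (l + 1) (l + 3)"
        "T 0 (l + 2) (l + 3) \<cdot> T 0 (l + 3) (l + 4) = T 0 (l + 2) (l + 4)"
        "T 0 (l + 3) (l + 2) = \<i> (T 0 (l + 2) (l + 3))"
        using 3 l by (intro cocycle_cmp(2)[OF T] C(2); simp)+
      consider "k < l" | "k = l" | "k = l + 1" | "k = l + 2" | q where "k = l + 3 + q"
        by (metis (no_types, lifting) Suc_1 add_Suc_right le_Suc_ex less_antisym not_less numeral_3_eq_3 One_nat_def add.right_neutral)
      then show "tuple_swap G i (tup n T) ! k = tup n (pull (transpose (i - 1) i) T) ! k"
        using il k e unfolding l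
        by cases (simp_all add: tuple_swap_def pull_def transpose_def nth_append eval_nat_numeral)
    qed (use 3 in \<open>auto simp: tuple_swap_def\<close>)
  next
    case 4
    then obtain l where l: "i = l + 3"
      by (metis add.commute le_Suc_ex)
    show ?thesis
    proof (rule nth_equalityI)
      fix k assume "k < length (tuple_swap G i (tup n T))"
      then have k: "k < n - 1"
        using 4 by (auto simp: tuple_swap_def split: if_splits)
      have e: "T 0 (l + 1) (l + 2) \<cdot> T 0 (l + 2) (l + 3) = T 0 (l + 1) (l + 3)"
        "T 0 (l + 3) (l + 2) = \<i> (T 0 (l + 2) (l + 3))"
        using 4 l by (intro cocycle_cmp(2)[OF T] C(2); simp)+
      have "k < l \<or> k = l \<or> k = l + 1"
        using k 4(2) l by linarith
      then show "tuple_swap G i (tup n T) ! k = tup n (pull (transpose (i - 1) i) T) ! k"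
        using 4(2)[symmetric] k e unfolding l
        by (elim disjE) (simp_all add: tuple_swap_def pull_def transpose_def nth_append eval_nat_numeral)
    qed (use 4 l in \<open>auto simp: tuple_swap_def\<close>)
  qed
qed

section \<open>Tuples and families determine the same simplices\<close>

lemma tup_in_tuples: "cocycle (Suc (Suc m)) T \<Longrightarrow> tup (Suc (Suc m)) T \<in> tuples G (Suc m)"
\<comment> \<open>The faces come from the families \<open>pull (coface i) T\<close>, so
  \<open>T\<close> has to vary in the induction.\<close>
proof (induction m arbitrary: T)
  case 0
  then show ?case
    using tup_2[of T] cocycleD(1)[OF 0, of 0 1 2] by (simp add: numeral_2_eq_2)
next
  case (Suc m)
  note T = Suc.prems and IH = Suc.IH
  have hc: "H_composable G (tup (Suc (Suc (Suc m))) T ! i) (tup (Suc (Suc (Suc m))) T ! (i + 1))"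
    if "i < m + 1" for i
    using that cocycle_H_composable[OF T, of 0 "Suc i" "Suc (Suc i)" "Suc (Suc (Suc i))"] by simp
  show ?case
  proof (cases m)
    case 0
    then show ?thesis
      using tup_3[of T] hc[of 0] by (auto simp: numeral_3_eq_3 numeral_2_eq_2)
  next
    case (Suc m')
    have "tuple_face G i (tup (Suc (Suc (Suc m))) T) \<in> tuples G (Suc m)"
      if "i \<in> {1..m' + 4}" for i
      using that IH[OF cocycle_coface[OF T]] tuple_face_tup[OF T] Suc by simp
    moreover have "set (tup (Suc (Suc (Suc m))) T) \<subseteq> gens G"
      using cocycleD(1)[OF T] by (auto simp: tup_def)
    ultimately show ?thesis
      using hc Suc by simp
  qed
qed

lemma tuples_length: "xs \<in> tuples G m \<Longrightarrow> length xs = m"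
  by (cases "(G, m)" rule: tuples.cases) auto

text \<open>Pairs have their own clause in \<open>tuples\<close>, without faces; there the faces
  \<open>[y]\<close>, \<open>[x \<cdot> y]\<close>, \<open>[x]\<close> are generators by
  H-composability. This gives later inductions a uniform step.\<close>

lemma tuplesD:
  assumes xs: "xs \<in> tuples G (Suc (Suc m))"
  shows "i < m + 1 \<Longrightarrow> H_composable G (xs ! i) (xs ! Suc i)"
    and "\<lbrakk>1 \<le> i; i \<le> m + 3\<rbrakk> \<Longrightarrow> tuple_face G i xs \<in> tuples G (Suc m)"
proof -
  show "H_composable G (xs ! i) (xs ! Suc i)" if "i < m + 1"
    using xs that by (cases m) auto
  show "tuple_face G i xs \<in> tuples G (Suc m)" if i: "1 \<le> i" "i \<le> m + 3"
  proof (cases m)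
    case 0
    then obtain x y where xy: "xs = [x, y]" "H_composable G x y"
      using xs by auto
    moreover have "i = 1 \<or> i = 2 \<or> i = 3"
      using i 0 by linarith
    ultimately show ?thesis
      using 0 H_composableD[OF xy(2)] by (auto simp: tuple_face_def)
  next
    case (Suc m')
    then show ?thesis
      using xs i by simp
  qed
qed

text \<open>The two outer faces strip entries off the ends until the block \<open>ys\<close> is the
  whole tuple; then face 2 multiplies its first two entries, down to a single generator. This is all
  that the construction of a family takes from the face conditions.\<close>

lemma list_cmp_sublist:
  "\<lbrakk>us @ ys @ vs \<in> tuples G (Suc m); ys \<noteq> []\<rbrakk> \<Longrightarrow> list_cmp G ys \<in> gens G"
proof (induction m arbitrary: us ys vs)
  case 0
  then show ?case
    by (auto simp: list_cmp_def append_eq_Cons_conv)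
next
  case (Suc m)
  note face = tuplesD(2)[OF Suc.prems(1)] and len = tuples_length[OF Suc.prems(1)]
  consider "us \<noteq> []" | "vs \<noteq> []" | "us = []" "vs = []"
    by blast
  then show ?case
  proof cases
    case 1
    then have "tl us @ ys @ vs \<in> tuples G (Suc m)"
      using face[of 1] by (simp add: tuple_face_def)
    then show ?thesis
      using Suc by blast
  next
    case 2
    then have "us @ ys @ butlast vs \<in> tuples G (Suc m)"
      using face[of "m + 3"] len by (simp add: tuple_face_def butlast_append)
    then show ?thesis
      using Suc by blast
  next
    case 3
    then obtain x y zs where ys: "ys = x # y # zs"
      using len by (auto simp: length_Suc_conv)
    then have "[] @ (x \<cdot> y # zs) @ [] \<in> tuples G (Suc m)"
      using face[of 2] 3 by (simp add: tuple_face_def numeral_2_eq_2)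
    then have "list_cmp G (x \<cdot> y # zs) \<in> gens G"
      using Suc.IH by blast
    then show ?thesis
      by (simp add: ys list_cmp_def)
  qed
qed

text \<open>With \<open>p b c = x\<^sub>b \<cdot> \<dots> \<cdot> x\<^sub>c\<^sub>-\<^sub>1\<close>, extended to all \<open>b, c \<ge> 1\<close> by inversion, the values at triples
  containing \<open>0\<close> are forced by the symmetries, and then \<open>T a b c = T a b 0 \<cdot> T a 0 c\<close>.  All cases
  have the form \<open>T a b c = (E a b)\<inverse> \<cdot> E a c\<close>, which makes the cocycle identity automatic.\<close>

lemma tuple_is_tup:
  assumes xs: "xs \<in> tuples G (Suc m)"
  obtains T where "cocycle (m + 2) T" "xs = tup (m + 2) T"
proof -
  define n where "n = m + 2"
  have len: "length xs = Suc m"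
    using tuples_length[OF xs] by simp
  have gens: "xs ! k \<in> gens G" if "k < Suc m" for k
    using list_cmp_sublist[of "take k xs" "[xs ! k]" "drop (Suc k) xs" m] xs that len
    by (simp add: list_cmp_def flip: id_take_nth_drop)
  have comp: "tgt G (xs ! k) = src G (xs ! Suc k)" if "Suc k < Suc m" for k
    using that xs H_composableD(3)[OF tuplesD(1)] by (cases m) auto
  \<comment> \<open>Starting from an identity makes the empty product available. Vertex
    \<open>b \<ge> 1\<close> belongs to \<open>f (b - 1)\<close>, because \<open>xs ! k\<close>
    joins the vertices \<open>k + 1\<close> and \<open>k + 2\<close>.\<close>
  define f where "f k = foldl (cmp G) (idn G (src G (xs ! 0))) (take k xs)" for k
  have f_0: "f 0 = idn G (src G (xs ! 0))"
    by (simp add: f_def)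
  have f_Suc: "f (Suc k) = f k \<cdot> xs ! k" if "k < Suc m" for k
    using that len by (simp add: f_def take_Suc_conv_app_nth)
  have f_props: "f k \<in> Mors G \<and> src G (f k) = src G (xs ! 0) \<and>
      (k < Suc m \<longrightarrow> tgt G (f k) = src G (xs ! k))" if "k \<le> Suc m" for k
    using that
  proof (induction k)
    case 0
    then show ?case
      using gens[of 0] by (simp add: f_0)
  next
    case (Suc k)
    then show ?case
      using gens[of k] comp[of k] by (simp add: f_Suc)
  qed
  have f_mor: "f k \<in> Mors G" "src G (f k) = src G (xs ! 0)" if "k \<le> Suc m" for k
    using f_props that by auto
  have f_step: "\<i> (f k) \<cdot> f (Suc k) = xs ! k" if "k < Suc m" for k
    using that f_props[of k] gens[of k] by (simp add: f_Suc opp_cmp_cancel)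
  have f_quotient: "\<i> (f j) \<cdot> f k = list_cmp G (take (k - j) (drop j xs))"
    if "j < k" "k \<le> Suc m" for j k
    using that
  proof (induction k)
    case (Suc k)
    show ?case
    proof (cases "j = k")
      case True
      then show ?thesis
        using Suc len f_step[of k] by (simp add: take_Suc_conv_app_nth list_cmp_def)
    next
      case False
      then have "j < k"
        using Suc by simp
      then have "take (Suc k - j) (drop j xs) = take (k - j) (drop j xs) @ [xs ! k]"
        using Suc len by (simp add: Suc_diff_le take_Suc_conv_app_nth)
      moreover have "\<i> (f j) \<cdot> f (Suc k) = (\<i> (f j) \<cdot> f k) \<cdot> xs ! k"
        using f_props[of j] f_props[of k] gens[of k] Suc.prems \<open>j < k\<close>
        by (simp add: f_Suc cmp_assoc)
      ultimately show ?thesis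
        using Suc \<open>j < k\<close> len by (simp add: list_cmp_append)
    qed
  qed simp
  define p where "p b c = \<i> (f (b - 1)) \<cdot> f (c - 1)" for b c
  define valid where "valid b \<longleftrightarrow> 1 \<le> b \<and> b \<le> n" for b
  have f_valid: "f (b - 1) \<in> Mors G" "src G (f (b - 1)) = src G (xs ! 0)" if "valid b" for b
    using f_mor[of "b - 1"] that by (auto simp: valid_def n_def)
  have p_i: "\<i> (p b c) = p c b" if "valid b" "valid c" for b c
    using f_valid that by (simp add: p_def opp_quotient)
  have p_cmp: "p b c \<cdot> p c d = p b d" if "valid b" "valid c" "valid d" for b c d
    using f_valid that by (simp add: p_def quotient_cmp)
  have p_ends: "src G (p b c) = tgt G (f (b - 1))" "tgt G (p b c) = tgt G (f (c - 1))"
    if "valid b" "valid c" for b c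
    using f_valid that by (simp_all add: p_def)
  have p_less: "p b c \<in> gens G" if "valid b" "valid c" "b < c" for b c
  proof -
    let ?j = "b - 1" and ?k = "c - 1"
    have jk: "?j < ?k" "?k \<le> Suc m"
      using that by (auto simp: valid_def n_def)
    have "take ?j xs @ take (?k - ?j) (drop ?j xs) @ drop (?k - ?j) (drop ?j xs) \<in> tuples G (Suc m)"
      using xs by (simp only: append_take_drop_id)
    then have "list_cmp G (take (?k - ?j) (drop ?j xs)) \<in> gens G"
      by (rule list_cmp_sublist) (use jk len in auto)
    then show ?thesis
      using f_quotient[OF jk] by (simp add: p_def)
  qed
  have p_gens: "p b c \<in> gens G" if "valid b" "valid c" "b \<noteq> c" for b c
    using that p_less p_i i_closed by (metis linorder_neqE_nat)
  have p_H: "H_composable G (p b c) (p c d)"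
    if "valid b" "valid c" "valid d" "b \<noteq> c" "b \<noteq> d" "c \<noteq> d" for b c d
    using that by (simp add: H_composable_def p_gens p_ends p_cmp)
  \<comment> \<open>The target of \<open>f (b - 1)\<close> plays the edge \<open>(0, b)\<close>, so
    this is the reversed edge \<open>(b, 0)\<close>.\<close>
  define ob where "ob b = star_ob G (tgt G (f (b - 1)))" for b
  have ob_Obs: "ob b \<in> Obs G" if "valid b" for b
    using that f_valid by (simp add: ob_def star_ob_closed)
  have src_jp: "src G (\<j> (p b c)) = ob b" if "valid b" "valid c" "b \<noteq> c" for b c
    using that star_ob_src[OF p_gens] by (simp add: ob_def p_ends)
  \<comment> \<open>Each base vertex gets a reference edge: \<open>(0, 1)\<close> for
    \<open>a = 0\<close>, and \<open>(a, 0)\<close> otherwise. \<open>E a b\<close> leads from it to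
    the edge \<open>(a, b)\<close>, and is an identity when the two coincide.\<close>
  define E where "E a b = (if a = 0 then f (b - 1) else if b = 0 then idn G (ob a) else \<j> (p a b))"
    for a b
  define T where "T a b c = \<i> (E a b) \<cdot> E a c" for a b c
  have valid: "valid b" if "b \<le> n" "b \<noteq> 0" for b
    using that by (simp add: valid_def)
  have E_mor: "E a b \<in> Mors G" "src G (E a b) = (if a = 0 then src G (xs ! 0) else ob a)"
    if "a \<le> n" "b \<le> n" "a \<noteq> b" for a b
    using that f_valid valid p_gens ob_Obs src_jp by (auto simp: E_def)
  have T_0: "T 0 b c = p b c" for b c
    by (simp add: T_def E_def p_def)
  have T_mid: "T a 0 c = \<j> (p a c)" if "valid a" "valid c" "a \<noteq> c" for a c
    using that p_gens ob_Obs src_jp by (auto simp: T_def E_def valid_def)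
  have T_last: "T a b 0 = \<i> (\<j> (p a b))" if "valid a" "valid b" "a \<noteq> b" for a b
    using that p_gens ob_Obs src_jp by (auto simp: T_def E_def valid_def)
  have T_star: "T a b c = p a b \<star> p b c"
    if "valid a" "valid b" "valid c" "a \<noteq> b" "a \<noteq> c" "b \<noteq> c" for a b c
    using that star_mor_eq[OF p_H[OF that]] p_cmp by (auto simp: T_def E_def valid_def)
  have T_gens: "T a b c \<in> gens G"
    if "a \<le> n" "b \<le> n" "c \<le> n" "a \<noteq> b" "a \<noteq> c" "b \<noteq> c" for a b c
  proof -
    consider "a = 0" | "b = 0" | "c = 0" | "a \<noteq> 0" "b \<noteq> 0" "c \<noteq> 0"
      by blast
    then show ?thesis
      using that valid by cases (simp_all add: T_0 T_mid T_last T_star p_gens p_H star_mor_closed)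
  qed
  have T_j: "T b a c = \<j> (T a b c)"
    if "a \<le> n" "b \<le> n" "c \<le> n" "a \<noteq> b" "a \<noteq> c" "b \<noteq> c" for a b c
  proof -
    consider "a = 0" | "b = 0" | "c = 0" | "a \<noteq> 0" "b \<noteq> 0" "c \<noteq> 0"
      by blast
    then show ?thesis
    proof cases
      \<comment> \<open>With 0 as last vertex the claim reads
        \<open>\<i> (\<j> (\<i> (p a b))) = \<j> (\<i> (\<j> (p a b)))\<close>, the braid
        relation.\<close>
      case 3
      then show ?thesis
        using that valid p_gens iji_eq_jij[of "p a b"] by (simp add: T_last flip: p_i[of a b])
    next
      \<comment> \<open>Away from vertex 0 the two forms of \<open>\<star>\<close> meet:
        \<open>T b a c\<close> is expanded as a quotient, and comparison with the definition of
        \<open>p a b \<star> p b c\<close> shows that the two values differ by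
        \<open>\<j>\<close>.\<close>
      case 4
      have "T b a c = \<i> (\<j> (p b a)) \<cdot> \<j> (p b c)"
        using 4 by (simp add: T_def E_def)
      also have "\<dots> = \<k> (p a b) \<cdot> \<j> (p b c)"
        using 4 that valid by (simp add: inv_k_def p_i)
      finally show ?thesis
        using 4 that valid H_composableD(4)[OF k_j_H_composable[OF p_H[of a b c]]]
        by (simp add: T_star[of a b c] star_mor_def)
    qed (use that valid p_gens in \<open>simp_all add: T_0 T_mid\<close>)
  qed
  have "cocycle n T"
  proof (rule cocycleI)
    fix a b c assume "a \<le> n" "b \<le> n" "c \<le> n" "a \<noteq> b" "a \<noteq> c" "b \<noteq> c"
    then show "T a c b = \<i> (T a b c)"
      by (simp add: T_def E_mor opp_quotient)
  next
    fix a b c d assume "a \<le> n" "b \<le> n" "c \<le> n" "d \<le> n"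
      "a \<noteq> b" "a \<noteq> c" "a \<noteq> d" "b \<noteq> c" "b \<noteq> d" "c \<noteq> d"
    then show "tgt G (T a b c) = src G (T a c d)" "T a b c \<cdot> T a c d = T a b d"
      by (simp_all add: T_def E_mor quotient_cmp)
  qed (fact T_gens T_j)+
  moreover have "xs = tup n T"
    by (rule nth_equalityI) (auto simp: len n_def T_0 p_def f_step)
  ultimately show thesis
    using that n_def by blast
qed

end

section \<open>Faces and transpositions of simplices\<close>

lemma pull_pull: "pull f (pull g T) = pull (g \<circ> f) T"
  by (simp add: pull_def fun_eq_iff)

lemma coface_coface: "i < j \<Longrightarrow> coface j \<circ> coface i = coface i \<circ> coface (j - 1)"
  by (auto simp: coface_def fun_eq_iff)

lemma transpose_coface_left:
  "1 \<le> i \<Longrightarrow> transpose (i - 1) i \<circ> coface i = coface (i - 1)"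
  by (auto simp: coface_def transpose_def fun_eq_iff)

lemma transpose_coface_right:
  "1 \<le> i \<Longrightarrow> transpose (i - 1) i \<circ> coface (i - 1) = coface i"
  by (auto simp: coface_def transpose_def fun_eq_iff)

text \<open>Both exchanged vertices lie above the omitted one, so they are renumbered downwards;
  \<open>i - 1 - 1\<close> matches the shape of \<open>swap_tup\<close> at index
  \<open>i - 1\<close>.\<close>

lemma transpose_coface_low:
  "k < i - 1 \<Longrightarrow> transpose (i - 1) i \<circ> coface k = coface k \<circ> transpose (i - 1 - 1) (i - 1)"
  by (auto simp: coface_def transpose_def fun_eq_iff)

lemma transpose_coface_high:
  "i < k \<Longrightarrow> transpose (i - 1) i \<circ> coface k = coface k \<circ> transpose (i - 1) i"
  by (auto simp: coface_def transpose_def fun_eq_iff)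

lemma face_Tuple: "2 \<le> length xs \<Longrightarrow> face G i (Tuple xs) = Tuple (tuple_face G i xs)"
  by (cases xs; cases "tl xs") auto

lemma swap_Tuple: "2 \<le> length xs \<Longrightarrow> swap G i (Tuple xs) = Tuple (tuple_swap G i xs)"
  by (cases xs; cases "tl xs") auto

context delta_groupoid
begin

lemma face_tup:
  "\<lbrakk>cocycle (Suc n) T; 2 \<le> n; i \<le> Suc n\<rbrakk>
    \<Longrightarrow> face G i (Tuple (tup (Suc n) T)) = Tuple (tup n (pull (coface i) T))"
  by (simp add: face_Tuple tuple_face_tup)

text \<open>The vertices other than \<open>i\<close> form the remaining edge, recovered as the
  source of the morphism whose third vertex is \<open>i\<close>.\<close>

lemma face_tup_2:
  assumes T: "cocycle 2 T" and i: "i \<le> 2"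
  shows "face G i (Tuple (tup 2 T)) = Object (src G (T (coface i 0) (coface i 1) i))"
proof -
  have "\<j> (T 0 1 2) = T 1 0 2" "T 1 2 0 = \<i> (T 1 0 2)" "T 0 2 1 = \<i> (T 0 1 2)"
    "T 0 1 2 \<in> gens G" "T 1 0 2 \<in> gens G"
    using cocycleD[OF T, of 0 1 2] cocycleD[OF T, of 1 0 2] by simp_all
  moreover have "i = 0 \<or> i = 1 \<or> i = 2"
    using i by linarith
  ultimately show ?thesis
    by (auto simp: tup_2 coface_def simp flip: numeral_2_eq_2)
qed

lemma swap_tup:
  assumes T: "cocycle n T" and n: "2 \<le> n" and i: "1 \<le> i" "i \<le> n"
  shows "swap G i (Tuple (tup n T)) = Tuple (tup n (pull (transpose (i - 1) i) T))"
proof (cases "n = 2")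
  case True
  have "T 1 0 2 = \<j> (T 0 1 2)" "T 0 2 1 = \<i> (T 0 1 2)"
    using cocycleD[OF T, of 0 1 2] True by simp_all
  moreover have "i = 1 \<or> i = 2"
    using i True by linarith
  ultimately show ?thesis
    using True by (auto simp: tup_2 pull_def transpose_def)
next
  case False
  then show ?thesis
    using assms by (simp add: swap_Tuple tuple_swap_tup)
qed

lemma tup_in_V: "\<lbrakk>cocycle n T; 2 \<le> n\<rbrakk> \<Longrightarrow> Tuple (tup n T) \<in> V G (int n)"
  using tup_in_tuples[of "n - 2" T]
  by (auto simp: V_def Suc_diff_Suc numeral_2_eq_2 nat_diff_distrib)

text \<open>Entry point for all later arguments: a simplex of dimension at least 2 is handed over as
  a family, in place of its recursive description.\<close>

lemma V_cases:
  assumes "v \<in> V G n"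
  obtains (point) "n = -1" "v = Point"
    | (component) A where "n = 0" "A \<in> Obs G" "v = Component (component G A)"
    | (object) A where "n = 1" "A \<in> Obs G" "v = Object A"
    | (tuple) m T where "n = int m" "2 \<le> m" "cocycle m T" "v = Tuple (tup m T)"
proof -
  consider "n < -1" | "n = -1" | "n = 0" | "n = 1" | "2 \<le> n"
    by linarith
  then show thesis
  proof cases
    case 5
    then obtain xs where xs: "v = Tuple xs" "xs \<in> tuples G (nat (n - 1))"
      using assms by (auto simp: V_def)
    moreover have "nat (n - 1) = Suc (nat n - 2)"
      using 5 by linarith
    ultimately obtain T where "cocycle (nat n - 2 + 2) T" "xs = tup (nat n - 2 + 2) T"
      using tuple_is_tup by metis
    moreover have "nat n - 2 + 2 = nat n"
      using 5 by linarith
    ultimately show thesis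
      using tuple[of "nat n" T] xs 5 by simp
  qed (use assms in \<open>auto simp: V_def intro: point component object\<close>)
qed

lemma dim_V: "v \<in> V G n \<Longrightarrow> dim v = n"
  by (erule V_cases) auto

text \<open>The edge picture in low dimensions: reversing an edge is \<open>star_ob\<close>, and
  \<open>T a b c\<close> itself connects the two edges at \<open>a\<close>.\<close>

lemma cocycle_ob:
  assumes "cocycle n T" "a \<le> n" "b \<le> n" "c \<le> n" "a \<noteq> b" "a \<noteq> c" "b \<noteq> c"
  shows "src G (T a b c) \<in> Obs G"
    and "star_ob G (src G (T a b c)) = src G (T b a c)"
    and "component G (src G (T a c b)) = component G (src G (T a b c))"
  using cocycleD[OF assms] star_ob_src[of "T a b c"] component_eq[of "T a b c"] by simp_all

text \<open>Index 0 is covered too: omitting vertex 0 pulls a family back to a family like any other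
  coface.\<close>

lemma face_in_V:
  assumes v: "v \<in> V G n" and i: "int i \<le> n"
  shows "face G i v \<in> V G (n - 1)"
  using v
proof (cases rule: V_cases)
  case (object A)
  then show ?thesis
    using star_ob_closed by (auto simp: V_def)
next
  case (tuple m T)
  show ?thesis
  proof (cases "m = 2")
    case True
    then have "src G (T (coface i 0) (coface i 1) i) \<in> Obs G"
      using tuple i by (intro cocycle_ob(1)[of 2]) (auto simp: coface_def)
    then show ?thesis
      using tuple i True face_tup_2[of T i] by (simp add: V_def)
  next
    case False
    then obtain l where l: "m = Suc l" "2 \<le> l"
      using tuple(2) by (cases m) auto
    then show ?thesis
      using tuple i tup_in_V[OF cocycle_coface[of l T i]] face_tup[of l T i] by simp
  qed
qed (use i in \<open>auto simp: V_def\<close>)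

lemma face_face:
  assumes v: "v \<in> V G n" and ij: "i < j" "int j \<le> n"
  shows "face G i (face G j v) = face G (j - 1) (face G i v)"
  using v
proof (cases rule: V_cases)
  case (tuple m T)
  consider "m = 2" | "m = 3" | "4 \<le> m"
    using tuple by linarith
  then show ?thesis
  proof cases
    case 1
    then have T: "cocycle 2 T"
      using tuple by simp
    have "i = 0 \<and> j = 1 \<or> i = 0 \<and> j = 2 \<or> i = 1 \<and> j = 2"
      using ij tuple 1 by auto
    then show ?thesis
      using tuple 1 face_tup_2[OF T] cocycle_ob(2)[OF T, of 0 2 1] cocycle_ob(2)[OF T, of 1 2 0]
        cocycle_ob(2)[OF T, of 0 1 2] component_eq[of "T 2 1 0"] cocycle_ob(3)[OF T, of 0 1 2]
        cocycle_ob(3)[OF T, of 1 0 2] cocycle_ob(3)[OF T, of 2 0 1]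
      by (auto simp: coface_def simp flip: numeral_2_eq_2)
  next
    case 2
    then have T: "cocycle (Suc 2) T"
      using tuple by (simp add: numeral_3_eq_3 numeral_2_eq_2)
    \<comment> \<open>Both routes end at the edge \<open>(a, b)\<close>, once read off the triangle
      \<open>a, b, i\<close> and once off \<open>a, b, j\<close>. The two sources agree because
      \<open>T a b i \<cdot> T a i j = T a b j\<close>.\<close>
    define a b where "a = coface j (coface i 0)" and "b = coface j (coface i 1)"
    have ab: "a = coface i (coface (j - 1) 0)" "b = coface i (coface (j - 1) 1)"
      using fun_cong[OF coface_coface[OF ij(1)]] by (simp_all add: a_def b_def)
    have le: "j \<le> 3" "i \<le> 2"
      using ij tuple 2 by auto
    have "tgt G (T a b i) = src G (T a i j)" "T a b i \<cdot> T a i j = T a b j"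
      "T a b i \<in> gens G" "T a i j \<in> gens G"
      unfolding a_def b_def coface_def
      by (intro cocycle_cmp[OF T] cocycleD(1)[OF T]; use le ij in auto)+
    then have "src G (T a b i) = src G (T a b j)"
      using cmp_simps(2)[of "T a b i" "T a i j"] by simp
    moreover have "coface j i = i" "coface i (j - 1) = j"
      using ij by (auto simp: coface_def)
    moreover have "cocycle 2 (pull (coface j) T)" "cocycle 2 (pull (coface i) T)"
      using le by (auto intro!: cocycle_coface[OF T])
    moreover have "face G x v = Tuple (tup 2 (pull (coface x) T))" if "x \<le> 3" for x
      using face_tup[OF T, of x] that tuple 2 by simp
    ultimately show ?thesis
      using le ij(1) by (simp add: face_tup_2 pull_def a_def b_def ab[unfolded a_def b_def, simplified])
  next
    case 3
    then have "m = Suc (Suc (m - 2))" "2 \<le> m - 2"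
      by linarith+
    then obtain l where l: "m = Suc (Suc l)" "2 \<le> l"
      by blast
    then show ?thesis
      using tuple ij coface_coface[OF ij(1)]
      by (simp add: face_tup cocycle_coface pull_pull)
  qed
qed (use ij in \<open>auto simp: V_def\<close>)

section \<open>Transpositions and their compatibility with faces\<close>

lemma swap_in_V:
  assumes v: "v \<in> V G n" and i: "1 \<le> i" "int i \<le> n"
  shows "swap G i v \<in> V G n"
  using v
proof (cases rule: V_cases)
  case (object A)
  then show ?thesis
    using star_ob_closed by (auto simp: V_def)
next
  case (tuple m T)
  then show ?thesis
    using i tup_in_V[OF cocycle_transpose] swap_tup by simp
qed (use i in auto)

text \<open>Exchanging two neighbouring vertices and omitting one of them leaves the other vertices
  in order, so no permutation remains on the face. In dimension 1 this is the involutivity of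
  \<open>star_ob\<close>.\<close>

lemma face_swap_same:
  assumes v: "v \<in> V G n" and i: "1 \<le> i" "int i \<le> n"
  shows "face G i (swap G i v) = face G (i - 1) v"
    and "face G (i - 1) (swap G i v) = face G i v"
proof -
  have "face G i (swap G i v) = face G (i - 1) v \<and> face G (i - 1) (swap G i v) = face G i v"
    using v
  proof (cases rule: V_cases)
    case (object A)
    then show ?thesis
      using i star_ob_star_ob by auto
  next
    case (tuple m T)
    then have le: "i \<le> m"
      using i by simp
    define T' where "T' = pull (transpose (i - 1) i) T"
    have T': "cocycle m T'"
      unfolding T'_def using tuple le by (intro cocycle_transpose)
    have swap: "swap G i v = Tuple (tup m T')"
      unfolding T'_def using tuple le i by (simp add: swap_tup)
    have pull: "pull (coface i) T' = pull (coface (i - 1)) T"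
      "pull (coface (i - 1)) T' = pull (coface i) T"
      unfolding T'_def pull_pull using transpose_coface_left transpose_coface_right i by auto
    show ?thesis
    proof (cases "m = 2")
      case True
      have "T' (coface i 0) (coface i 1) i = T (coface (i - 1) 0) (coface (i - 1) 1) (i - 1)"
        "T' (coface (i - 1) 0) (coface (i - 1) 1) (i - 1) = T (coface i 0) (coface i 1) i"
        using fun_cong[OF transpose_coface_left[OF i(1)]] fun_cong[OF transpose_coface_right[OF i(1)]]
        by (simp_all add: T'_def pull_def)
      then show ?thesis
        unfolding swap using True tuple le T' by (simp add: face_tup_2)
    next
      case False
      then obtain l where "m = Suc l" "2 \<le> l"
        using tuple(2) by (cases m) auto
      then show ?thesis
        unfolding swap using tuple le T' pull by (simp add: face_tup)
    qed
  qed (use i in auto)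
  then show "face G i (swap G i v) = face G (i - 1) v"
    and "face G (i - 1) (swap G i v) = face G i v"
    by auto
qed

lemma face_swap_low:
  assumes v: "v \<in> V G n" and i: "1 \<le> i" "int i \<le> n" and k: "k < i - 1"
  shows "face G k (swap G i v) = swap G (i - 1) (face G k v)"
  using v
proof (cases rule: V_cases)
  case (tuple m T)
  then have le: "i \<le> m"
    using i by simp
  show ?thesis
  proof (cases "m = 2")
    case True
    then have T: "cocycle 2 T"
      using tuple by simp
    \<comment> \<open>In dimension 2 only this case remains; the face is an edge, and the induced
      transposition is its reversal.\<close>
    then have "i = 2" "k = 0"
      using True i k le by auto
    then show ?thesis
      using tuple True cocycle_transpose[OF T, of 2] cocycle_ob(2)[OF T, of 1 2 0]
      by (simp add: swap_tup face_tup_2 coface_def pull_def transpose_def flip: numeral_2_eq_2)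
  next
    case False
    then obtain l where "m = Suc l" "2 \<le> l"
      using tuple(2) by (cases m) auto
    then have *: "cocycle (Suc l) T" "v = Tuple (tup (Suc l) T)" "i \<le> Suc l" "2 \<le> l"
      using tuple le by auto
    have "face G k (swap G i v) = Tuple (tup l (pull (transpose (i - 1) i \<circ> coface k) T))"
      using * i k face_tup[OF cocycle_transpose[of "Suc l" T i], of k] by (simp add: swap_tup pull_pull)
    moreover have "swap G (i - 1) (face G k v)
        = Tuple (tup l (pull (coface k \<circ> transpose (i - 1 - 1) (i - 1)) T))"
      using * i k swap_tup[OF cocycle_coface[of l T k], of "i - 1"] by (simp add: face_tup pull_pull)
    ultimately show ?thesis
      using transpose_coface_low[OF k] by simp
  qed
qed (use i k in auto)

lemma face_swap_high:
  assumes v: "v \<in> V G n" and i: "1 \<le> i" and k: "i < k" "int k \<le> n"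
  shows "face G k (swap G i v) = swap G i (face G k v)"
  using v
proof (cases rule: V_cases)
  case (tuple m T)
  then have le: "k \<le> m"
    using k by simp
  show ?thesis
  proof (cases "m = 2")
    case True
    then have T: "cocycle 2 T"
      using tuple by simp
    then have "i = 1" "k = 2"
      using True i k le by auto
    then show ?thesis
      using tuple True cocycle_transpose[OF T, of 1] cocycle_ob(2)[OF T, of 0 1 2]
      by (simp add: swap_tup face_tup_2 coface_def pull_def transpose_def flip: numeral_2_eq_2)
  next
    case False
    then obtain l where "m = Suc l" "2 \<le> l"
      using tuple(2) by (cases m) auto
    then have *: "cocycle (Suc l) T" "v = Tuple (tup (Suc l) T)" "k \<le> Suc l" "2 \<le> l"
      using tuple le by auto
    have "face G k (swap G i v) = Tuple (tup l (pull (transpose (i - 1) i \<circ> coface k) T))"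
      using * i k face_tup[OF cocycle_transpose[of "Suc l" T i], of k] by (simp add: swap_tup pull_pull)
    moreover have "swap G i (face G k v)
        = Tuple (tup l (pull (coface k \<circ> transpose (i - 1) i) T))"
      using * i k swap_tup[OF cocycle_coface[of l T k], of i] by (simp add: face_tup pull_pull)
    ultimately show ?thesis
      using transpose_coface_high[OF k(1)] by simp
  qed
qed (use i k in auto)

end

section \<open>The boundary operator\<close>

text \<open>The terms with \<open>i < j\<close> are matched with those with \<open>j \<le> i\<close>
  by sending \<open>(j, i)\<close> to \<open>(i, j - 1)\<close>, which preserves the basis element
  and flips the sign.\<close>

lemma alternating_double_sum_eq_0:
  fixes F :: "nat \<Rightarrow> nat \<Rightarrow> 'a"
  assumes F: "\<And>i j. \<lbrakk>i < j; j \<le> Suc n\<rbrakk> \<Longrightarrow> F i j = F (j - 1) i"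
  shows "(\<Sum>j\<le>Suc n. \<Sum>i\<le>n. frag_cmul ((-1) ^ (i + j)) (frag_of (F i j))) = 0"
proof -
  let ?t = "\<lambda>(j, i). frag_cmul ((-1) ^ (i + j)) (frag_of (F i j))"
  let ?L = "{(j, i). j \<le> Suc n \<and> i < j}" and ?R = "{(j, i). j \<le> i \<and> i \<le> n}"
  have fin: "finite ?L" "finite ?R"
    by (rule finite_subset[of _ "{..Suc n} \<times> {..Suc n}"]; auto)+
  have "(\<Sum>j\<le>Suc n. \<Sum>i\<le>n. frag_cmul ((-1) ^ (i + j)) (frag_of (F i j)))
      = sum ?t ({..Suc n} \<times> {..n})"
    by (rule sum.cartesian_product)
  also have "{..Suc n} \<times> {..n} = ?L \<union> ?R"
    by auto
  also have "sum ?t (?L \<union> ?R) = sum ?t ?L + sum ?t ?R"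
    by (rule sum.union_disjoint[OF fin]) auto
  also have "sum ?t ?L = (\<Sum>x\<in>?R. - ?t x)"
  proof (rule sum.reindex_bij_witness[of _ "\<lambda>(j, i). (Suc i, j)" "\<lambda>(j, i). (i, j - 1)"])
    fix x assume "x \<in> ?L"
    then show "- ?t (case x of (j, i) \<Rightarrow> (i, j - 1)) = ?t x"
      by (cases x; cases "fst x") (auto simp: F add.commute)
  qed auto
  finally show ?thesis
    by (simp add: sum_negf)
qed

lemma generate_free_Abelian_group_frag_of:
  "generate (free_Abelian_group S) (frag_of ` S) = carrier (free_Abelian_group S)"
  (is "?A = _")
proof
  interpret group "free_Abelian_group S"
    by simp
  show "?A \<subseteq> carrier (free_Abelian_group S)"
    by (rule generate_incl) auto
  have sub: "subgroup ?A (free_Abelian_group S)"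
    by (rule generate_is_subgroup) auto
  show "carrier (free_Abelian_group S) \<subseteq> ?A"
  proof
    fix x assume "x \<in> carrier (free_Abelian_group S)"
    then have "Poly_Mapping.keys x \<subseteq> S"
      by simp
    then show "x \<in> ?A"
    proof (induction rule: free_Abelian_group_induct[consumes 1])
      case 1
      then show ?case
        using subgroup.one_closed[OF sub] by simp
    next
      case (2 x y)
      then have "x \<otimes>\<^bsub>free_Abelian_group S\<^esub> inv\<^bsub>free_Abelian_group S\<^esub> y \<in> ?A"
        using subgroup.m_closed[OF sub] subgroup.m_inv_closed[OF sub] by blast
      then show ?case
        using 2 by simp
    next
      case (3 a)
      then show ?case
        by (auto intro: generate.incl)
    qed
  qed
qed

lemma subgroup_free_Abelian_group_mono:
  assumes "S \<subseteq> T"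
  shows "subgroup (carrier (free_Abelian_group S)) (free_Abelian_group T)"
proof -
  interpret group "free_Abelian_group T"
    by simp
  show ?thesis
  proof (rule subgroupI)
    fix x y assume "x \<in> carrier (free_Abelian_group S)" "y \<in> carrier (free_Abelian_group S)"
    then show "inv\<^bsub>free_Abelian_group T\<^esub> x \<in> carrier (free_Abelian_group S)"
      and "x \<otimes>\<^bsub>free_Abelian_group T\<^esub> y \<in> carrier (free_Abelian_group S)"
      using assms keys_add[of x y] by auto
  next
    have "0 \<in> carrier (free_Abelian_group S)"
      by simp
    then show "carrier (free_Abelian_group S) \<noteq> {}"
      by blast
  qed (use assms in auto)
qed

lemma hom_frag_extend:
  assumes "\<And>v. v \<in> S \<Longrightarrow> Poly_Mapping.keys (f v) \<subseteq> T"
  shows "frag_extend f \<in> hom (free_Abelian_group S) (free_Abelian_group T)"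
proof (rule homI)
  fix x assume "x \<in> carrier (free_Abelian_group S)"
  then show "frag_extend f x \<in> carrier (free_Abelian_group T)"
    using assms keys_frag_extend[of f x] by fastforce
qed (simp add: frag_extend_add)

lemma (in group_hom) hom_generate_subset:
  assumes "S \<subseteq> carrier G" "subgroup K H" "h ` S \<subseteq> K"
  shows "h ` generate G S \<subseteq> K"
  using generate_img[OF assms(1)] H.generate_subgroup_incl[OF assms(3,2)] by simp

context delta_groupoid
begin

section \<open>The boundary of a simplex and its square\<close>

lemma boundary_frag_of:
  assumes "v \<in> V G (int n)"
  shows "boundary G (frag_of v) = (\<Sum>i\<le>n. frag_cmul ((-1) ^ i) (frag_of (face G i v)))"
proof -
  have "{i. int i \<le> dim v} = {..n}"
    using dim_V[OF assms] by auto
  then show ?thesis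
    by (simp add: boundary_def)
qed

text \<open>The sum is empty because \<open>dim Point = -1\<close>.\<close>

lemma boundary_Point: "boundary G (frag_of Point) = 0"
  by (simp add: boundary_def)

lemma V_nat_cases:
  assumes "v \<in> V G n"
  obtains "n = -1" "v = Point" | m where "n = int m" "v \<in> V G (int m)"
proof (cases "n = -1")
  case True
  then show thesis
    using assms that(1) by (simp add: V_def)
next
  case False
  then have "0 \<le> n"
    using assms by (simp add: V_def split: if_splits)
  then show thesis
    using assms that(2)[of "nat n"] by simp
qed

lemma keys_boundary:
  assumes "v \<in> V G n"
  shows "Poly_Mapping.keys (boundary G (frag_of v)) \<subseteq> V G (n - 1)"
  using assms
proof (cases rule: V_nat_cases)
  case 1
  then show ?thesis
    by (simp add: boundary_Point)
next
  case (2 m)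
  have "frag_cmul ((-1) ^ i) (frag_of (face G i v)) \<in> carrier (free_Abelian_group (V G (n - 1)))"
    if "i \<in> {..m}" for i
    using face_in_V[OF assms, of i] 2 that by (auto simp: keys_frag_of)
  then show ?thesis
    unfolding boundary_frag_of[OF 2(2)] carrier_free_Abelian_group_iff[symmetric]
    by (rule sum_closed_free_Abelian_group)
qed

lemma boundary_boundary_frag_of:
  assumes "v \<in> V G n"
  shows "boundary G (boundary G (frag_of v)) = 0"
  using assms
proof (cases rule: V_nat_cases)
  case 1
  then show ?thesis
    by (simp add: boundary_Point) (simp add: boundary_def)
next
  case (2 m)
  have *: "boundary G (boundary G (frag_of v))
      = (\<Sum>j\<le>m. frag_cmul ((-1) ^ j) (boundary G (frag_of (face G j v))))"
    unfolding boundary_frag_of[OF 2(2)]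
    by (simp add: boundary_def frag_extend_sum frag_extend_cmul)
  show ?thesis
  proof (cases m)
    \<comment> \<open>The single face of a component is the point, which has zero boundary; the
      double sum starts at \<open>m > 0\<close>.\<close>
    case 0
    then have "face G 0 v \<in> V G (- 1)"
      using face_in_V[OF 2(2), of 0] by simp
    then show ?thesis
      using 0 * boundary_Point by (simp add: V_def)
  next
    case (Suc l)
    have "boundary G (boundary G (frag_of v))
        = (\<Sum>j\<le>Suc l. \<Sum>i\<le>l. frag_cmul ((-1) ^ (i + j)) (frag_of (face G i (face G j v))))"
      unfolding * Suc
    proof (rule sum.cong)
      fix j assume "j \<in> {..Suc l}"
      then have "face G j v \<in> V G (int l)"
        using face_in_V[OF 2(2), of j] Suc by simp
      then show "frag_cmul ((-1) ^ j) (boundary G (frag_of (face G j v)))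
          = (\<Sum>i\<le>l. frag_cmul ((-1) ^ (i + j)) (frag_of (face G i (face G j v))))"
        by (simp add: boundary_frag_of frag_cmul_sum power_add mult.commute)
    qed simp
    also have "\<dots> = 0"
      using face_face[OF 2(2)] Suc by (intro alternating_double_sum_eq_0) auto
    finally show ?thesis .
  qed
qed

lemma group_hom_boundary:
  "group_hom (free_Abelian_group (\<Union>n. V G n)) (free_Abelian_group (\<Union>n. V G n)) (boundary G)"
proof -
  have "Poly_Mapping.keys (\<Sum>i | int i \<le> dim v. frag_cmul ((-1) ^ i) (frag_of (face G i v)))
      \<subseteq> (\<Union>n. V G n)" if "v \<in> (\<Union>n. V G n)" for v
    using that keys_boundary by (fastforce simp: boundary_def)
  then have "boundary G \<in> hom (free_Abelian_group (\<Union>n. V G n)) (free_Abelian_group (\<Union>n. V G n))"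
    unfolding boundary_def by (rule hom_frag_extend)
  then show ?thesis
    by (simp add: group_hom_def group_hom_axioms_def)
qed

section \<open>The grading and the chain complex\<close>

lemma V_disjoint: "\<lbrakk>v \<in> V G m; v \<in> V G n\<rbrakk> \<Longrightarrow> m = n"
  using dim_V by blast

lemma B_deg_subgroup: "subgroup (B_deg G n) (B G)"
  unfolding B_deg_def B_def by (rule subgroup_free_Abelian_group_mono) auto

lemma boundary_B_deg:
  assumes "x \<in> B_deg G n"
  shows "boundary G x \<in> B_deg G (n - 1)"
proof -
  have "boundary G \<in> hom (free_Abelian_group (V G n)) (free_Abelian_group (V G (n - 1)))"
    unfolding boundary_def using keys_boundary by (intro hom_frag_extend) (simp add: boundary_def)
  then show ?thesis
    using assms unfolding B_deg_def by (rule hom_in_carrier)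
qed

lemma chain_complex_B: "chain_complex (B G) (B_deg G) (boundary G)"
proof -
  let ?F = "free_Abelian_group (\<Union>n. V G n)"
  interpret comm_group ?F
    by (rule abelian_free_Abelian_group)
  show ?thesis
    unfolding B_def
  proof (intro chain_complex.intro chain_complex_axioms.intro)
    show "comm_group ?F"
      by (rule abelian_free_Abelian_group)
    show "subgroup (B_deg G n) ?F" for n
      using B_deg_subgroup by (simp add: B_def)
    have "frag_of ` (\<Union>n. V G n) \<subseteq> (\<Union>n. B_deg G n)"
      by (auto simp: B_deg_def)
    then have "carrier ?F \<subseteq> generate ?F (\<Union>n. B_deg G n)"
      using mono_generate generate_free_Abelian_group_frag_of by metis
    moreover have "generate ?F (\<Union>n. B_deg G n) \<subseteq> carrier ?F"
      by (rule generate_incl) (use subgroup.subset[OF B_deg_subgroup, unfolded B_def] in blast)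
    ultimately show "generate ?F (\<Union>n. B_deg G n) = carrier ?F"
      by auto
    \<comment> \<open>A common element is supported both in \<open>V G n\<close> and in the union of
      the other sets \<open>V G m\<close>. These are disjoint, so the support is empty.\<close>
    show "B_deg G n \<inter> generate ?F (\<Union>m\<in>-{n}. B_deg G m) = {\<one>\<^bsub>?F\<^esub>}" for n
    proof
      have "generate ?F (\<Union>m\<in>-{n}. B_deg G m)
          \<subseteq> carrier (free_Abelian_group (\<Union>m\<in>-{n}. V G m))"
      proof (rule generate_subgroup_incl[OF _ subgroup_free_Abelian_group_mono])
        show "(\<Union>m\<in>-{n}. B_deg G m) \<subseteq> carrier (free_Abelian_group (\<Union>m\<in>-{n}. V G m))"
          by (intro UN_least) (simp add: B_deg_def subset_iff, blast)
      qed auto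
      moreover have "V G n \<inter> (\<Union>m\<in>-{n}. V G m) = {}"
        using V_disjoint by auto
      ultimately show "B_deg G n \<inter> generate ?F (\<Union>m\<in>-{n}. B_deg G m) \<subseteq> {\<one>\<^bsub>?F\<^esub>}"
        by (fastforce simp: B_deg_def simp flip: keys_eq_empty)
    qed (auto simp: B_deg_def intro: generate.one[of ?F, simplified])
    show "boundary G \<in> hom ?F ?F"
      using group_hom_boundary by (rule group_hom.homh)
    show "boundary G ` B_deg G n \<subseteq> B_deg G (n - 1)" for n
      using boundary_B_deg by auto
    fix x assume "x \<in> carrier ?F"
    then have "Poly_Mapping.keys x \<subseteq> (\<Union>n. V G n)"
      by simp
    then have "boundary G (boundary G x) = 0"
    proof (induction rule: free_Abelian_group_induct[consumes 1])
      case (2 x y)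
      then show ?case
        by (simp add: boundary_def frag_extend_diff)
    qed (auto simp: boundary_boundary_frag_of, simp add: boundary_def)
    then show "boundary G (boundary G x) = \<one>\<^bsub>?F\<^esub>"
      by simp
  qed
qed

section \<open>The subgroup spanned by the sums of a simplex and its transposed simplex\<close>

definition swap_generators :: "(('o, 'm) simplex \<Rightarrow>\<^sub>0 int) set" where
  "swap_generators = {frag_of v + frag_of (swap G i v) | n i v.
     1 \<le> n \<and> v \<in> V G n \<and> 1 \<le> i \<and> int i \<le> n}"

lemma swap_subgroup_eq: "swap_subgroup G = generate (B G) swap_generators"
  by (simp add: swap_subgroup_def swap_generators_def)

text \<open>Transpositions preserve the dimension. This is what makes the generated subgroup
  graded.\<close>

lemma swap_generators_homogeneous:
  assumes "x \<in> swap_generators"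
  obtains n where "x \<in> B_deg G n"
proof -
  obtain n i v where "x = frag_of v + frag_of (swap G i v)" "v \<in> V G n" "1 \<le> i" "int i \<le> n"
    using assms by (auto simp: swap_generators_def)
  then have "x \<in> B_deg G n"
    using keys_add[of "frag_of v" "frag_of (swap G i v)"] swap_in_V[of v n i]
    by (auto simp: B_deg_def keys_frag_of)
  then show thesis
    by (rule that)
qed

lemma swap_generators_carrier: "swap_generators \<subseteq> carrier (B G)"
proof
  fix x assume "x \<in> swap_generators"
  then obtain n where "x \<in> B_deg G n"
    by (rule swap_generators_homogeneous)
  then show "x \<in> carrier (B G)"
    using subgroup.subset[OF B_deg_subgroup] by blast
qed

lemma group_B: "group (B G)"
  by (simp add: B_def)

lemma swap_subgroup_subgroup: "subgroup (swap_subgroup G) (B G)"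
  unfolding swap_subgroup_eq
  by (rule group.generate_is_subgroup[OF group_B swap_generators_carrier])

lemma swap_generator_in_subgroup:
  assumes "v \<in> V G n" "1 \<le> i" "int i \<le> n"
  shows "frag_of v + frag_of (swap G i v) \<in> swap_subgroup G"
proof -
  have "1 \<le> n"
    using assms by linarith
  then show ?thesis
    unfolding swap_subgroup_eq swap_generators_def using assms by (blast intro: generate.incl)
qed

lemma swap_subgroup_closed:
  shows "0 \<in> swap_subgroup G"
    and "\<lbrakk>x \<in> swap_subgroup G; y \<in> swap_subgroup G\<rbrakk> \<Longrightarrow> x + y \<in> swap_subgroup G"
    and "x \<in> swap_subgroup G \<Longrightarrow> - x \<in> swap_subgroup G"
proof -
  note S = swap_subgroup_subgroup
  show "0 \<in> swap_subgroup G"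
    using subgroup.one_closed[OF S] by (simp add: B_def)
  show "x + y \<in> swap_subgroup G" if "x \<in> swap_subgroup G" "y \<in> swap_subgroup G"
    using subgroup.m_closed[OF S that] by (simp add: B_def)
  show "- x \<in> swap_subgroup G" if "x \<in> swap_subgroup G"
    using subgroup.m_inv_closed[OF S that] subgroup.mem_carrier[OF S that] by (simp add: B_def)
qed

text \<open>The faces with indices \<open>i - 1\<close> and \<open>i\<close> are exchanged by \<open>s\<^sub>i\<close> and cancel because they carry
  opposite signs; on every other face \<open>s\<^sub>i\<close> induces an adjacent transposition.\<close>

lemma boundary_swap_generator:
  assumes v: "v \<in> V G n" and i: "1 \<le> i" "int i \<le> n"
  shows "boundary G (frag_of v + frag_of (swap G i v)) \<in> swap_subgroup G"
proof -
  obtain m where m: "n = int m"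
    using i by (metis int_ops(1) nonneg_int_cases of_nat_0_le_iff order_trans)
  define g where "g k = frag_of (face G k v) + frag_of (face G k (swap G i v))" for k
  have swap: "swap G i v \<in> V G n"
    using swap_in_V[OF v i] .
  have "boundary G (frag_of v + frag_of (swap G i v))
      = boundary G (frag_of v) + boundary G (frag_of (swap G i v))"
    by (simp add: boundary_def frag_extend_add)
  also have "\<dots> = (\<Sum>k\<le>m. frag_cmul ((-1) ^ k) (g k))"
    using v swap by (simp add: m boundary_frag_of g_def frag_cmul_distrib2 sum.distrib)
  also have "\<dots> = (\<Sum>k\<in>{..m} - {i - 1, i}. frag_cmul ((-1) ^ k) (g k))
      + (\<Sum>k\<in>{i - 1, i}. frag_cmul ((-1) ^ k) (g k))"
    using i m by (intro sum.subset_diff) auto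
  also have "(\<Sum>k\<in>{i - 1, i}. frag_cmul ((-1) ^ k) (g k)) = 0"
  proof -
    have "g (i - 1) = g i"
      unfolding g_def using face_swap_same[OF v i] by (simp add: add.commute)
    moreover have "(-1 :: int) ^ i = - ((-1) ^ (i - 1))"
      using i by (cases i) auto
    ultimately show ?thesis
      using i by (simp flip: frag_cmul_distrib)
  qed
  also have "(\<Sum>k\<in>{..m} - {i - 1, i}. frag_cmul ((-1) ^ k) (g k)) + 0 \<in> swap_subgroup G"
  proof -
    have g: "g k \<in> swap_subgroup G" if k: "k \<in> {..m} - {i - 1, i}" for k
    proof -
      have face: "face G k v \<in> V G (n - 1)"
        using face_in_V[OF v] k m by simp
      \<comment> \<open>Either way the induced transposition is admissible in degree
        \<open>n - 1\<close>: the first case gives \<open>i - 1 \<ge> 1\<close>, the second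
        \<open>i \<le> n - 1\<close>.\<close>
      consider "k < i - 1" | "i < k"
        using k i by fastforce
      then show ?thesis
      proof cases
        case 1
        then show ?thesis
          unfolding g_def face_swap_low[OF v i 1]
          using i by (intro swap_generator_in_subgroup[OF face]) auto
      next
        case 2
        then show ?thesis
          using k m i face_swap_high[OF v i(1) 2] unfolding g_def
          by (auto intro!: swap_generator_in_subgroup[OF face])
      qed
    qed
    have "frag_cmul ((-1) ^ k) (g k) \<in> swap_subgroup G" if "k \<in> {..m} - {i - 1, i}" for k
      using g[OF that] swap_subgroup_closed(3) by (cases "even k") auto
    \<comment> \<open>Passing to subsets \<open>K\<close> of the index set lets the induction on
      finite sets keep the membership of the individual terms.\<close>
    then have "(\<Sum>k\<in>K. frag_cmul ((-1) ^ k) (g k)) \<in> swap_subgroup G"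
      if "K \<subseteq> {..m} - {i - 1, i}" for K
      using that swap_subgroup_closed(1,2) by (induction K rule: infinite_finite_induct) auto
    then show ?thesis
      by simp
  qed
  finally show ?thesis .
qed

lemma chain_subcomplex_swap_subgroup:
  "chain_subcomplex (B G) (B_deg G) (boundary G) (swap_subgroup G)"
proof -
  interpret chain_complex "B G" "B_deg G" "boundary G"
    by (rule chain_complex_B)
  show ?thesis
  proof (intro chain_subcomplex.intro chain_subcomplex_axioms.intro)
    show "chain_complex (B G) (B_deg G) (boundary G)"
      by (rule chain_complex_B)
    show "subgroup (swap_subgroup G) (B G)"
      by (rule swap_subgroup_subgroup)
    have "generate (B G) (\<Union>n. swap_subgroup G \<inter> B_deg G n) \<subseteq> swap_subgroup G"
      by (rule generate_subgroup_incl[OF _ swap_subgroup_subgroup]) auto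
    moreover have "swap_generators \<subseteq> (\<Union>n. swap_subgroup G \<inter> B_deg G n)"
      unfolding swap_subgroup_eq
      by (auto intro: generate.incl elim: swap_generators_homogeneous)
    then have "swap_subgroup G \<subseteq> generate (B G) (\<Union>n. swap_subgroup G \<inter> B_deg G n)"
      unfolding swap_subgroup_eq by (rule mono_generate)
    ultimately show "generate (B G) (\<Union>n. swap_subgroup G \<inter> B_deg G n) = swap_subgroup G"
      by auto
    \<comment> \<open>Since the boundary is a homomorphism, stability need only be checked on
      generators.\<close>
    have "boundary G ` swap_generators \<subseteq> swap_subgroup G"
      using boundary_swap_generator by (auto simp: swap_generators_def)
    then show "boundary G ` swap_subgroup G \<subseteq> swap_subgroup G"
      using group_hom.hom_generate_subset[of "B G" "B G" "boundary G" swap_generators "swap_subgroup G"]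
        group_hom_boundary swap_generators_carrier swap_subgroup_subgroup
      unfolding swap_subgroup_eq B_def by auto
  qed
qed

end

theorem proposition14:
  fixes G :: "('o, 'm, 'z) delta_data_scheme"
  assumes "delta_groupoid G"
  shows "chain_subcomplex (B G) (B_deg G) (boundary G) (swap_subgroup G)"
  using assms by (rule delta_groupoid.chain_subcomplex_swap_subgroup)

end
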